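(* Let $\alpha>0$. For each $t>0$ the heat measure $\pi(t,\cdot)$ on $\overline{K}$ is not absolutely continuous with respect to $\mu$.
   Context: Let $k$ be a non-Archimedean local field of characteristic zero with normalized absolute value $|\cdot|_1$, and let $k=K_1\subset K_2\subset\cdots\subset K_n\subset\cdots$ be an increasing sequence of finite extensions of $k$ such that $K=\bigcup_{n\ge 1}K_n$ is an infinite extension of $k$. Let $m_n=[K_n:k]$ and let $\|\cdot\|$ be the extension of $|\cdot|_1$ to $K$. For $x\in K_\nu$, $\nu>n$, put $T_n(x)=\frac{m_n}{m_\nu}\mathrm{Tr}_{K_\nu/K_n}(x)$, and $T_n(x)=x$ for $x\in K_n$; this gives well-defined maps $T_n:K\to K_n$ with $T_n\circ T_\nu=T_n$ for $\nu>n$. Write $T=T_1$. Let $\overline{K}$ be the projective limit of $\{K_n\}$ with respect to $\{T_n\}$, i.e. the set of $x=(x_1,x_2,\ldots)\in\prod_n K_n$ with $x_n=T_n(x_\nu)$ for $\nu>n$, with the topology given by the seminorms $\|x\|_n=\|x_n\|$. For $x\in K_n\subset K$ and $y=(y_1,y_2,\ldots)\in\overline{K}$ put $\langle x,y\rangle=T(xy_n)\in k$ (this does not depend on the choice of $n$). Let $\chi$ be a rank zero additive character of $k$ (trivial on the ring of integers of $k$, but on no larger ball). Let $\mu$ be the Borel probability measure on $\overline{K}$ with $\int_{\overline{K}}\chi(\langle a,x\rangle)\,d\mu(x)=\Omega(a)$ for all $a\in K$, where $\Omega(a)=1$ if $\|a\|\le 1$ and $\Omega(a)=0$ if $\|a\|>1$.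 For $\alpha>0$, $t>0$, the heat measure $\pi(t,dx)$ is the Borel probability measure on $\overline{K}$ defined by $$\int_{\overline{K}}\chi(\langle\lambda,x\rangle)\,\pi(t,dx)=\rho_\alpha(\|\lambda\|,t),\quad\lambda\in K,$$ where $\rho_\alpha(s,t)=e^{-ts^\alpha}$ if $s>1$ and $\rho_\alpha(s,t)=1$ if $0\le s\le1$. (The existence of $\pi(t,\cdot)$ is known.) *)

theory Defs
  imports "HOL-Probability.Probability" "HOL-Algebra.Algebra"
begin

text \<open>
  Throughout, the infinite extension is the field \<open>R\<close> (with carrier), and the tower of finite
  extensions is a sequence \<open>F\<close> of subfields of \<open>R\<close>. The sequence is indexed from 0,
  so that \<open>F 0\<close> is the base field and \<open>F n\<close> is the member of the tower usually written
  with index \<open>n + 1\<close>.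
\<close>

section \<open>Local fields\<close>

definition nonarch_absval :: "('a, 'b) ring_scheme \<Rightarrow> 'a set \<Rightarrow> ('a \<Rightarrow> real) \<Rightarrow> bool" where
  "nonarch_absval R k v \<longleftrightarrow>
     (\<forall>x\<in>k. 0 \<le> v x \<and> (v x = 0 \<longleftrightarrow> x = \<zero>\<^bsub>R\<^esub>)) \<and>
     (\<forall>x\<in>k. \<forall>y\<in>k. v (x \<otimes>\<^bsub>R\<^esub> y) = v x * v y) \<and>
     (\<forall>x\<in>k. \<forall>y\<in>k. v (x \<oplus>\<^bsub>R\<^esub> y) \<le> max (v x) (v y))"

text \<open>The value 0 off \<open>k\<close> is needed because the locale \<^locale>\<open>Metric_space\<close> asks for
  symmetry and nonnegativity on the whole type.\<close>

definition absval_dist :: "('a, 'b) ring_scheme \<Rightarrow> 'a set \<Rightarrow> ('a \<Rightarrow> real) \<Rightarrow> 'a \<Rightarrow> 'a \<Rightarrow> real" where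
  "absval_dist R k v x y = (if x \<in> k \<and> y \<in> k then v (x \<ominus>\<^bsub>R\<^esub> y) else 0)"

definition integer_ring :: "('a, 'b) ring_scheme \<Rightarrow> 'a set \<Rightarrow> ('a \<Rightarrow> real) \<Rightarrow> ('a, 'b) ring_scheme" where
  "integer_ring R k v = R\<lparr>carrier := {x \<in> k. v x \<le> 1}\<rparr>"

definition residue_field :: "('a, 'b) ring_scheme \<Rightarrow> 'a set \<Rightarrow> ('a \<Rightarrow> real) \<Rightarrow> 'a set ring" where
  "residue_field R k v = integer_ring R k v Quot {x \<in> k. v x < 1}"

definition char_zero :: "('a, 'b) ring_scheme \<Rightarrow> bool" where
  "char_zero R \<longleftrightarrow> (\<forall>n::nat. n > 0 \<longrightarrow> [n] \<cdot>\<^bsub>R\<^esub> \<one>\<^bsub>R\<^esub> \<noteq> \<zero>\<^bsub>R\<^esub>)"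

text \<open>Complete for a nontrivial discrete absolute value, with finite residue field.\<close>

definition nonarch_local_field :: "('a, 'b) ring_scheme \<Rightarrow> 'a set \<Rightarrow> ('a \<Rightarrow> real) \<Rightarrow> bool" where
  "nonarch_local_field R k v \<longleftrightarrow>
     subfield k R \<and> nonarch_absval R k v \<and>
     (\<exists>x\<in>k - {\<zero>\<^bsub>R\<^esub>}. v x \<noteq> 1) \<and>
     (\<exists>c<1. \<forall>x\<in>k. v x < 1 \<longrightarrow> v x \<le> c) \<and>
     Metric_space.mcomplete k (absval_dist R k v) \<and>
     finite (carrier (residue_field R k v))"

text \<open>A uniformizer has absolute value \<open>1/q\<close>, with \<open>q\<close> the order of the residue field.\<close>

definition normalized_absval :: "('a, 'b) ring_scheme \<Rightarrow> 'a set \<Rightarrow> ('a \<Rightarrow> real) \<Rightarrow> bool" where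
  "normalized_absval R k v \<longleftrightarrow>
     v ` (k - {\<zero>\<^bsub>R\<^esub>}) = range (\<lambda>j::int. real (order (residue_field R k v)) powi j)"

definition additive_character ::
  "('a, 'b) ring_scheme \<Rightarrow> 'a set \<Rightarrow> ('a \<Rightarrow> real) \<Rightarrow> ('a \<Rightarrow> complex) \<Rightarrow> bool" where
  "additive_character R k v \<psi> \<longleftrightarrow>
     continuous_map (Metric_space.mtopology k (absval_dist R k v)) euclidean \<psi> \<and>
     (\<forall>x\<in>k. norm (\<psi> x) = 1) \<and>
     (\<forall>x\<in>k. \<forall>y\<in>k. \<psi> (x \<oplus>\<^bsub>R\<^esub> y) = \<psi> x * \<psi> y)"

text \<open>Distinct radii may give the same ball, so larger balls are compared as sets.\<close>

definition rank_zero ::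
  "'a set \<Rightarrow> ('a \<Rightarrow> real) \<Rightarrow> ('a \<Rightarrow> complex) \<Rightarrow> bool" where
  "rank_zero k v \<psi> \<longleftrightarrow>
     (\<forall>x\<in>k. v x \<le> 1 \<longrightarrow> \<psi> x = 1) \<and>
     (\<forall>r. {x \<in> k. v x \<le> 1} \<subset> {x \<in> k. v x \<le> r} \<longrightarrow> (\<exists>x\<in>k. v x \<le> r \<and> \<psi> x \<noteq> 1))"

section \<open>The tower and its normalized traces\<close>

definition extension_tower :: "('a, 'b) ring_scheme \<Rightarrow> (nat \<Rightarrow> 'a set) \<Rightarrow> bool" where
  "extension_tower R F \<longleftrightarrow>
     (\<forall>n. subfield (F n) R) \<and> (\<forall>n. F n \<subseteq> F (Suc n)) \<and>
     (\<forall>n. ring.finite_dimension R (F 0) (F n)) \<and>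
     carrier R = (\<Union>n. F n) \<and>
     \<not> ring.finite_dimension R (F 0) (carrier R)"

definition tower_degree :: "('a, 'b) ring_scheme \<Rightarrow> (nat \<Rightarrow> 'a set) \<Rightarrow> nat \<Rightarrow> nat" where
  "tower_degree R F n = ring.dim R (F 0) (F n)"

definition is_basis :: "('a, 'b) ring_scheme \<Rightarrow> 'a set \<Rightarrow> 'a set \<Rightarrow> 'a list \<Rightarrow> bool" where
  "is_basis R E L us \<longleftrightarrow>
     set us \<subseteq> carrier R \<and> ring.independent R E us \<and> ring.Span R E us = L"

definition coords :: "('a, 'b) ring_scheme \<Rightarrow> 'a set \<Rightarrow> 'a list \<Rightarrow> 'a \<Rightarrow> 'a list" where
  "coords R E us x =
     (THE cs. set cs \<subseteq> E \<and> length cs = length us \<and> ring.combine R cs us = x)"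

text \<open>The trace of \<open>L\<close> over \<open>E\<close>: the trace of the \<open>E\<close>-linear map of multiplication by \<open>x\<close>
  on \<open>L\<close>, that is, the sum of the diagonal entries of its matrix in a basis.\<close>

definition field_trace :: "('a, 'b) ring_scheme \<Rightarrow> 'a set \<Rightarrow> 'a set \<Rightarrow> 'a \<Rightarrow> 'a" where
  "field_trace R E L x =
     (let us = (SOME us. is_basis R E L us)
      in \<Oplus>\<^bsub>R\<^esub>i\<in>{..<length us}. coords R E us (x \<otimes>\<^bsub>R\<^esub> us ! i) ! i)"

text \<open>By transitivity of the trace, any admissible \<open>\<nu>\<close> gives the same value.\<close>

definition normalized_trace :: "('a, 'b) ring_scheme \<Rightarrow> (nat \<Rightarrow> 'a set) \<Rightarrow> nat \<Rightarrow> 'a \<Rightarrow> 'a" where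
  "normalized_trace R F n x =
     (if x \<in> F n then x
      else let \<nu> = (LEAST \<nu>. n < \<nu> \<and> x \<in> F \<nu>) in
        ([tower_degree R F n] \<cdot>\<^bsub>R\<^esub> \<one>\<^bsub>R\<^esub> \<otimes>\<^bsub>R\<^esub> inv\<^bsub>R\<^esub> ([tower_degree R F \<nu>] \<cdot>\<^bsub>R\<^esub> \<one>\<^bsub>R\<^esub>))
        \<otimes>\<^bsub>R\<^esub> field_trace R (F n) (F \<nu>) x)"

section \<open>The projective limit\<close>

definition proj_limit :: "('a, 'b) ring_scheme \<Rightarrow> (nat \<Rightarrow> 'a set) \<Rightarrow> (nat \<Rightarrow> 'a) set" where
  "proj_limit R F =
     {x. (\<forall>n. x n \<in> F n) \<and> (\<forall>n \<nu>. n < \<nu> \<longrightarrow> x n = normalized_trace R F n (x \<nu>))}"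

text \<open>The topology of the seminorms \<open>x \<mapsto> v (x n)\<close>.\<close>

definition proj_limit_topology ::
  "('a, 'b) ring_scheme \<Rightarrow> (nat \<Rightarrow> 'a set) \<Rightarrow> ('a \<Rightarrow> real) \<Rightarrow> (nat \<Rightarrow> 'a) topology" where
  "proj_limit_topology R F v =
     topology_generated_by
       {{y \<in> proj_limit R F. v (y n \<ominus>\<^bsub>R\<^esub> x n) < r} | n x r. x \<in> proj_limit R F \<and> r > 0}"

definition proj_limit_borel ::
  "('a, 'b) ring_scheme \<Rightarrow> (nat \<Rightarrow> 'a set) \<Rightarrow> ('a \<Rightarrow> real) \<Rightarrow> (nat \<Rightarrow> 'a) measure" where
  "proj_limit_borel R F v = sigma (proj_limit R F) {U. openin (proj_limit_topology R F v) U}"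

text \<open>The value does not depend on the choice of \<open>n\<close> with \<open>a \<in> F n\<close>.\<close>

definition tower_pairing ::
  "('a, 'b) ring_scheme \<Rightarrow> (nat \<Rightarrow> 'a set) \<Rightarrow> 'a \<Rightarrow> (nat \<Rightarrow> 'a) \<Rightarrow> 'a" where
  "tower_pairing R F a y = normalized_trace R F 0 (a \<otimes>\<^bsub>R\<^esub> y (LEAST n. a \<in> F n))"

section \<open>Measures with prescribed Fourier transform\<close>

definition borel_prob_with_fourier ::
  "('a, 'b) ring_scheme \<Rightarrow> (nat \<Rightarrow> 'a set) \<Rightarrow> ('a \<Rightarrow> real) \<Rightarrow> ('a \<Rightarrow> complex) \<Rightarrow>
   (nat \<Rightarrow> 'a) measure \<Rightarrow> ('a \<Rightarrow> real) \<Rightarrow> bool" where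
  "borel_prob_with_fourier R F v \<psi> M g \<longleftrightarrow>
     prob_space M \<and> sets M = sets (proj_limit_borel R F v) \<and>
     (\<forall>a\<in>carrier R. (\<integral>x. \<psi> (tower_pairing R F a x) \<partial>M) = complex_of_real (g a))"

definition rho :: "real \<Rightarrow> real \<Rightarrow> real \<Rightarrow> real" where
  "rho \<alpha> s t = (if s > 1 then exp (- t * s powr \<alpha>) else 1)"

definition is_mu ::
  "('a, 'b) ring_scheme \<Rightarrow> (nat \<Rightarrow> 'a set) \<Rightarrow> ('a \<Rightarrow> real) \<Rightarrow> ('a \<Rightarrow> complex) \<Rightarrow>
   (nat \<Rightarrow> 'a) measure \<Rightarrow> bool" where
  "is_mu R F v \<psi> M \<longleftrightarrow>
     borel_prob_with_fourier R F v \<psi> M (\<lambda>a. if v a \<le> 1 then 1 else 0)"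

definition is_heat_measure ::
  "('a, 'b) ring_scheme \<Rightarrow> (nat \<Rightarrow> 'a set) \<Rightarrow> ('a \<Rightarrow> real) \<Rightarrow> ('a \<Rightarrow> complex) \<Rightarrow>
   real \<Rightarrow> real \<Rightarrow> (nat \<Rightarrow> 'a) measure \<Rightarrow> bool" where
  "is_heat_measure R F v \<psi> \<alpha> t M \<longleftrightarrow>
     borel_prob_with_fourier R F v \<psi> M (\<lambda>a. rho \<alpha> (v a) t)"

end

theory Submission
  imports Defs
begin

text \<open>
  Each \<open>a\<close> in the infinite extension gives the function \<open>y \<mapsto> \<psi> \<langle>a, y\<rangle>\<close> of absolute value 1 on the
  projective limit, and the functions of \<open>a\<close> and \<open>b\<close> have the inner product \<open>\<Omega>(a - b)\<close> in
  \<open>L\<^sup>2(\<mu>)\<close>, where \<open>\<Omega>\<close> is the Fourier transform of \<open>\<mu>\<close>. Elements at mutual distance above 1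
  therefore give an orthonormal system for \<open>\<mu>\<close>. If they are also bounded, by \<open>C\<close> say, then the mean
  of each function under the heat measure is at least \<open>c = exp (- t * C powr \<alpha>) > 0\<close>. For an
  infinite sequence of such elements, the averages of the functions tend to 0 in \<open>L\<^sup>2(\<mu>)\<close>, hence
  along a subsequence almost everywhere for \<open>\<mu>\<close>, while their means under the heat measure never
  fall below \<open>c\<close>. By dominated convergence this excludes absolute continuity
  (\<open>not_absolutely_continuous_if_orthonormal\<close>).

  A bounded infinite sequence with mutual distances above 1 exists because the extension is infinite
  (\<open>separated_sequence\<close>). Otherwise the ring of integers of the extension would be finite modulo
  \<open>p\<close>, for an element \<open>p\<close> of the base field with \<open>0 < v p < 1\<close>, and successive approximation with
  coefficients in the complete base field would show that finitely many integers span the extension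
  (\<open>finite_dimension_if_finite_net\<close>).

  The inner products are given by the Fourier transform because \<open>\<langle>a, y\<rangle>\<close> is additive in \<open>a\<close>
  (\<open>tower_pairing_add\<close>). This needs the pairing at a level high enough for two elements at once, and
  so its independence of the level (\<open>tower_pairing_step\<close>), which rests on the transitivity of the
  trace (\<open>field_trace_trans\<close>). To obtain it, the trace is computed with arbitrary dual bases, for
  which both the independence of the choice and the passage to a tower are interchanges of finite
  sums.
\<close>

section \<open>Orthonormal sequences and absolute continuity\<close>

text \<open>
  Pythagoras: the mean of \<open>n\<close> orthonormal vectors has squared length \<open>n / n\<^sup>2\<close>.
\<close>

lemma integral_norm_average_orthonormal:
  fixes Y :: "nat \<Rightarrow> 'a \<Rightarrow> complex"
  assumes M: "prob_space M"
    and meas: "\<And>i. Y i \<in> borel_measurable M"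
    and norm1: "\<And>i x. x \<in> space M \<Longrightarrow> norm (Y i x) = 1"
    and orth: "\<And>i j. i \<noteq> j \<Longrightarrow> (\<integral>x. Y i x * cnj (Y j x) \<partial>M) = 0"
    and n: "n > 0"
  shows "(\<integral>x. (norm ((\<Sum>i<n. Y i x) / of_nat n))\<^sup>2 \<partial>M) = 1 / real n"
proof -
  interpret prob_space M by fact
  have [measurable]: "Y i \<in> borel_measurable M" for i by (rule meas)
  have [measurable]: "cnj \<in> borel_measurable borel"
    by (intro borel_measurable_continuous_onI continuous_intros)
  have int: "integrable M (\<lambda>x. Y i x * cnj (Y j x))" for i j
    using norm1 by (intro integrable_const_bound[where B = 1]) (auto simp: norm_mult)
  have diag: "(\<integral>x. Y i x * cnj (Y i x) \<partial>M) = 1" for i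
  proof -
    have "(\<integral>x. Y i x * cnj (Y i x) \<partial>M) = (\<integral>x. 1 \<partial>M)"
      using norm1 by (intro Bochner_Integration.integral_cong) (auto simp: complex_norm_square[symmetric])
    then show ?thesis by (simp add: prob_space)
  qed
  have sq: "complex_of_real ((norm ((\<Sum>i<n. Y i x) / of_nat n))\<^sup>2)
      = (\<Sum>i<n. \<Sum>j<n. Y i x * cnj (Y j x)) / (of_nat n)\<^sup>2" for x
    unfolding complex_norm_square by (simp add: sum_product power2_eq_square)
  have "complex_of_real (\<integral>x. (norm ((\<Sum>i<n. Y i x) / of_nat n))\<^sup>2 \<partial>M)
      = (\<integral>x. (\<Sum>i<n. \<Sum>j<n. Y i x * cnj (Y j x)) / (of_nat n)\<^sup>2 \<partial>M)"
    by (simp only: integral_complex_of_real[symmetric] sq)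
  also have "\<dots> = (\<Sum>i<n. \<Sum>j<n. (\<integral>x. Y i x * cnj (Y j x) \<partial>M)) / (of_nat n)\<^sup>2"
    using int by simp
  also have "\<dots> = (\<Sum>i<n. \<Sum>j<n. if j = i then 1 else 0) / (of_nat n)\<^sup>2"
    using diag orth by (intro arg_cong2[where f = "(/)"] sum.cong refl) auto
  also have "\<dots> = complex_of_real (1 / real n)"
    using n by (simp add: power2_eq_square)
  finally show ?thesis unfolding of_real_eq_iff .
qed

text \<open>
  The averages of the \<open>Y i\<close> tend to 0 in \<open>L\<^sup>2(M)\<close>, hence along a subsequence almost everywhere
  for \<open>M\<close>. Were \<open>N\<close> absolutely continuous, they would also tend to 0 almost everywhere for \<open>N\<close>;
  as they are bounded by 1, so would their \<open>N\<close>-means, which stay above \<open>c\<close>.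
\<close>

lemma not_absolutely_continuous_if_orthonormal:
  fixes Y :: "nat \<Rightarrow> 'a \<Rightarrow> complex"
  assumes M: "prob_space M" and N: "prob_space N" and sets: "sets N = sets M"
    and meas: "\<And>i. Y i \<in> borel_measurable M"
    and norm1: "\<And>i x. x \<in> space M \<Longrightarrow> norm (Y i x) = 1"
    and orth: "\<And>i j. i \<noteq> j \<Longrightarrow> (\<integral>x. Y i x * cnj (Y j x) \<partial>M) = 0"
    and c: "c > 0" and mean: "\<And>i. c \<le> Re (\<integral>x. Y i x \<partial>N)"
  shows "\<not> absolutely_continuous M N"
proof
  assume ac: "absolutely_continuous M N"
  interpret M: prob_space M by fact
  interpret N: prob_space N by fact
  have space: "space N = space M" using sets by (rule sets_eq_imp_space_eq)
  \<comment> \<open>The average has \<open>Suc n\<close> terms, so that no index gives a division by 0.\<close>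
  define S where "S n x = (\<Sum>i<Suc n. Y i x) / of_nat (Suc n)" for n x
  have S_meas [measurable]: "S n \<in> borel_measurable M" for n
    unfolding S_def using meas by measurable
  have S_measN: "S n \<in> borel_measurable N" for n
    using S_meas measurable_cong_sets[OF sets refl] by blast
  have measN: "Y n \<in> borel_measurable N" for n
    using meas measurable_cong_sets[OF sets refl] by blast
  have S_bound: "norm (S n x) \<le> 1" if "x \<in> space M" for n x
  proof -
    have "norm (\<Sum>i<Suc n. Y i x) \<le> (\<Sum>i<Suc n. 1)"
      using norm1[OF that] by (intro sum_norm_le) simp
    then show ?thesis by (simp add: S_def norm_divide del: sum.lessThan_Suc of_nat_Suc)
  qed
  have "integrable M (\<lambda>x. (norm (S n x))\<^sup>2)" for n
    using S_bound by (intro M.integrable_const_bound[where B = 1]) (auto simp: power_le_one)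
  moreover have "(\<lambda>n. \<integral>x. norm ((norm (S n x))\<^sup>2) \<partial>M) \<longlonglongrightarrow> 0"
  proof -
    have "(\<integral>x. norm ((norm (S n x))\<^sup>2) \<partial>M) = 1 / real (Suc n)" for n
      using integral_norm_average_orthonormal[where n = "Suc n", OF M meas norm1 orth]
      by (simp add: S_def del: sum.lessThan_Suc)
    then show ?thesis using LIMSEQ_Suc[OF lim_1_over_n] by (simp del: of_nat_Suc)
  qed
  ultimately obtain r where r: "strict_mono r"
    and "AE x in M. (\<lambda>n. (norm (S (r n) x))\<^sup>2) \<longlonglongrightarrow> 0"
    using tendsto_L1_AE_subseq[of M "\<lambda>n x. (norm (S n x))\<^sup>2"] by blast
  then have "AE x in N. (\<lambda>n. (norm (S (r n) x))\<^sup>2) \<longlonglongrightarrow> 0"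
    using absolutely_continuous_AE[OF sets ac] by blast
  then have "AE x in N. (\<lambda>n. S (r n) x) \<longlonglongrightarrow> 0"
  proof (rule AE_mp, intro AE_I2 impI)
    fix x assume "(\<lambda>n. (norm (S (r n) x))\<^sup>2) \<longlonglongrightarrow> 0"
    from tendsto_real_sqrt[OF this] have "(\<lambda>n. norm (S (r n) x)) \<longlonglongrightarrow> 0" by simp
    then show "(\<lambda>n. S (r n) x) \<longlonglongrightarrow> 0" by (rule tendsto_norm_zero_cancel)
  qed
  then have "(\<lambda>n. \<integral>x. S (r n) x \<partial>N) \<longlonglongrightarrow> (\<integral>x. 0 \<partial>N)"
    using S_measN S_bound space
    by (intro integral_dominated_convergence[where w = "\<lambda>_. 1"]) auto
  then have lim: "(\<lambda>n. Re (\<integral>x. S (r n) x \<partial>N)) \<longlonglongrightarrow> 0"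
    using tendsto_Re by fastforce
  have intX: "integrable N (Y i)" for i
    using measN norm1 space by (intro N.integrable_const_bound[where B = 1]) auto
  have "c \<le> Re (\<integral>x. S n x \<partial>N)" for n
  proof -
    have "(\<integral>x. S n x \<partial>N) = (\<Sum>i<Suc n. \<integral>x. Y i x \<partial>N) / of_nat (Suc n)"
      unfolding S_def using intX
      by (simp add: Bochner_Integration.integral_sum del: sum.lessThan_Suc)
    then have "Re (\<integral>x. S n x \<partial>N) = (\<Sum>i<Suc n. Re (\<integral>x. Y i x \<partial>N)) / real (Suc n)"
      by (simp only: Re_divide_of_nat Re_sum)
    moreover have "(\<Sum>i<Suc n. c) \<le> (\<Sum>i<Suc n. Re (\<integral>x. Y i x \<partial>N))"
      using mean by (intro sum_mono)
    then have "real (Suc n) * c \<le> (\<Sum>i<Suc n. Re (\<integral>x. Y i x \<partial>N))" by simp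
    ultimately show ?thesis by (simp only: le_divide_eq) (simp add: mult.commute)
  qed
  with LIMSEQ_le_const[OF lim] have "c \<le> 0" by blast
  with c show False by simp
qed

section \<open>Finite sums in rings\<close>

context ring begin

lemma finsum_swap:
  assumes "finite A" "finite B" "\<And>i j. i \<in> A \<Longrightarrow> j \<in> B \<Longrightarrow> f i j \<in> carrier R"
  shows "(\<Oplus>i\<in>A. \<Oplus>j\<in>B. f i j) = (\<Oplus>j\<in>B. \<Oplus>i\<in>A. f i j)"
  using assms(1,3)
proof (induction A rule: finite_induct)
  case empty
  then show ?case by simp
next
  case (insert x A)
  have "(\<Oplus>i\<in>insert x A. \<Oplus>j\<in>B. f i j) = (\<Oplus>j\<in>B. f x j) \<oplus> (\<Oplus>j\<in>B. \<Oplus>i\<in>A. f i j)"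
    using insert by (subst finsum_insert) (auto simp: Pi_def intro!: finsum_closed)
  also have "\<dots> = (\<Oplus>j\<in>B. f x j \<oplus> (\<Oplus>i\<in>A. f i j))"
    using insert by (subst finsum_addf) (auto simp: Pi_def intro!: finsum_closed)
  also have "\<dots> = (\<Oplus>j\<in>B. \<Oplus>i\<in>insert x A. f i j)"
    using insert
    by (intro finsum_cong') (auto simp: Pi_def intro!: finsum_closed)
  finally show ?case .
qed

lemma finsum_Times:
  assumes "finite A" "finite B" "\<And>i j. i \<in> A \<Longrightarrow> j \<in> B \<Longrightarrow> f i j \<in> carrier R"
  shows "(\<Oplus>p\<in>A \<times> B. f (fst p) (snd p)) = (\<Oplus>i\<in>A. \<Oplus>j\<in>B. f i j)"
  using assms(1,3)
proof (induction A rule: finite_induct)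
  case empty
  then show ?case by simp
next
  case (insert x A)
  have split: "insert x A \<times> B = Pair x ` B \<union> A \<times> B" by auto
  have "(\<Oplus>p\<in>insert x A \<times> B. f (fst p) (snd p))
      = (\<Oplus>p\<in>Pair x ` B. f (fst p) (snd p)) \<oplus> (\<Oplus>p\<in>A \<times> B. f (fst p) (snd p))"
    unfolding split using insert assms(2)
    by (intro finsum_Un_disjoint) (auto simp: Pi_def)
  also have "(\<Oplus>p\<in>Pair x ` B. f (fst p) (snd p)) = (\<Oplus>j\<in>B. f x j)"
    using insert by (subst finsum_reindex) (auto simp: Pi_def inj_on_def)
  also have "(\<Oplus>p\<in>A \<times> B. f (fst p) (snd p)) = (\<Oplus>i\<in>A. \<Oplus>j\<in>B. f i j)"
    using insert by auto
  finally show ?case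
    using insert by (subst finsum_insert) (auto simp: Pi_def intro!: finsum_closed)
qed

lemma finsum_in_subring:
  assumes "subring L R" "f \<in> I \<rightarrow> L"
  shows "finsum R f I \<in> L"
  using assms(2)
proof (induction I rule: infinite_finite_induct)
  case (infinite I)
  then show ?case using subringE(2)[OF assms(1)] by (simp add: finsum_infinite)
next
  case empty
  then show ?case using subringE(2)[OF assms(1)] by simp
next
  case (insert x I)
  have "L \<subseteq> carrier R" using subringE(1)[OF assms(1)] .
  with insert show ?case
    by (subst finsum_insert) (auto simp: Pi_def intro!: subringE(7)[OF assms(1)])
qed

lemma combine_eq_finsum:
  assumes "length cs = length us" "set cs \<subseteq> carrier R" "set us \<subseteq> carrier R"
  shows "combine cs us = (\<Oplus>i\<in>{..<length us}. cs ! i \<otimes> us ! i)"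
  using assms
proof (induction cs us rule: list_induct2)
  case Nil
  then show ?case by simp
next
  case (Cons c cs u us)
  have "{..<length (u # us)} = insert 0 (Suc ` {..<length us})"
    by (simp add: lessThan_Suc_eq_insert_0)
  moreover have cs: "\<And>i. i < length us \<Longrightarrow> cs ! i \<otimes> us ! i \<in> carrier R"
    using Cons.prems Cons.hyps by (metis m_closed nth_mem list.set_intros(2) subsetD)
  moreover have "(\<Oplus>i\<in>Suc ` {..<length us}. (c # cs) ! i \<otimes> (u # us) ! i)
      = (\<Oplus>i\<in>{..<length us}. cs ! i \<otimes> us ! i)"
    using cs by (subst finsum_reindex) (auto simp: Pi_def)
  moreover have "(\<Oplus>i\<in>insert 0 (Suc ` {..<length us}). (c # cs) ! i \<otimes> (u # us) ! i)
      = c \<otimes> u \<oplus> (\<Oplus>i\<in>Suc ` {..<length us}. (c # cs) ! i \<otimes> (u # us) ! i)"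
    using cs Cons.prems by (subst finsum_insert) (auto simp: Pi_def)
  ultimately show ?case
    using Cons by simp
qed

end

section \<open>Dual bases and the trace\<close>

context ring begin

text \<open>
  A finite family \<open>u\<close> of elements of \<open>L\<close> with \<open>E\<close>-linear coordinate functionals \<open>\<phi> i\<close> that
  reproduce every element. Linearity and the reproducing identity alone determine the trace
  \<open>\<Sum>i. \<phi> i (x * u i)\<close>, and they pass to towers by a single interchange of sums. The index type is free, so that pairs can index the products in a tower.
\<close>

definition dual_basis ::
  "'a set \<Rightarrow> 'a set \<Rightarrow> 'i set \<Rightarrow> ('i \<Rightarrow> 'a) \<Rightarrow> ('i \<Rightarrow> 'a \<Rightarrow> 'a) \<Rightarrow> bool" where
  "dual_basis E L I u \<phi> \<longleftrightarrow> finite I \<and> u \<in> I \<rightarrow> L \<and>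
     (\<forall>i\<in>I. \<phi> i \<in> L \<rightarrow> E \<and>
        (\<forall>x\<in>L. \<forall>y\<in>L. \<phi> i (x \<oplus> y) = \<phi> i x \<oplus> \<phi> i y) \<and>
        (\<forall>c\<in>E. \<forall>x\<in>L. \<phi> i (c \<otimes> x) = c \<otimes> \<phi> i x)) \<and>
     (\<forall>x\<in>L. (\<Oplus>i\<in>I. \<phi> i x \<otimes> u i) = x)"

lemma linear_finsum:
  assumes E: "subring E R" and L: "subring L R" and "E \<subseteq> L" and "finite I"
    and \<phi>: "\<phi> \<in> L \<rightarrow> E"
    and add: "\<And>x y. x \<in> L \<Longrightarrow> y \<in> L \<Longrightarrow> \<phi> (x \<oplus> y) = \<phi> x \<oplus> \<phi> y"
    and smult: "\<And>c x. c \<in> E \<Longrightarrow> x \<in> L \<Longrightarrow> \<phi> (c \<otimes> x) = c \<otimes> \<phi> x"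
    and c: "c \<in> I \<rightarrow> E" and w: "w \<in> I \<rightarrow> L"
  shows "\<phi> (\<Oplus>i\<in>I. c i \<otimes> w i) = (\<Oplus>i\<in>I. c i \<otimes> \<phi> (w i))"
  using \<open>finite I\<close> c w
proof (induction I rule: finite_induct)
  case empty
  have z: "\<zero> \<in> E" "\<zero> \<in> L" using subringE(2)[OF E] subringE(2)[OF L] by auto
  have "\<phi> (\<zero> \<otimes> \<zero>) = \<zero> \<otimes> \<phi> \<zero>" using smult[of \<zero> \<zero>] z by auto
  moreover have "\<phi> \<zero> \<in> carrier R" using \<phi> z subringE(1)[OF E] by blast
  ultimately show ?case by simp
next
  case (insert x I)
  note carr = subringE(1)[OF E] subringE(1)[OF L]
  have cw: "c i \<otimes> w i \<in> L" if "i \<in> insert x I" for i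
    using insert.prems that \<open>E \<subseteq> L\<close> subringE(6)[OF L] by (auto simp: Pi_def)
  have cp: "c i \<otimes> \<phi> (w i) \<in> carrier R" if "i \<in> insert x I" for i
    using insert.prems that carr \<phi> by (auto simp: Pi_def subset_iff)
  have cwR: "c i \<otimes> w i \<in> carrier R" if "i \<in> insert x I" for i
    using cw[OF that] carr by auto
  have "(\<Oplus>i\<in>insert x I. c i \<otimes> w i) = c x \<otimes> w x \<oplus> (\<Oplus>i\<in>I. c i \<otimes> w i)"
    using insert.hyps cwR by (subst finsum_insert) (auto simp: Pi_def)
  moreover have "(\<Oplus>i\<in>I. c i \<otimes> w i) \<in> L"
    using cw by (intro finsum_in_subring[OF L]) auto
  moreover have "\<phi> (c x \<otimes> w x) = c x \<otimes> \<phi> (w x)"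
    using insert.prems by (intro smult) auto
  ultimately have "\<phi> (\<Oplus>i\<in>insert x I. c i \<otimes> w i) = c x \<otimes> \<phi> (w x) \<oplus> (\<Oplus>i\<in>I. c i \<otimes> \<phi> (w i))"
    using add[OF cw[of x]] insert by auto
  also have "\<dots> = (\<Oplus>i\<in>insert x I. c i \<otimes> \<phi> (w i))"
    using insert.hyps cp by (subst finsum_insert) (auto simp: Pi_def)
  finally show ?case .
qed

end

context cring begin

text \<open>
  Expanding \<open>u i\<close> in the family \<open>w\<close> turns the left side into the double sum of
  \<open>\<theta> j (u i) * \<phi> i (x * w j)\<close> over \<open>i\<close> and \<open>j\<close>. The sum over \<open>i\<close> is \<open>\<theta> j\<close> applied to the
  expansion of \<open>x * w j\<close> in the family \<open>u\<close>.
\<close>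

lemma dual_basis_trace_unique:
  assumes E: "subring E R" and L: "subring L R" and EL: "E \<subseteq> L"
    and u: "dual_basis E L I u \<phi>" and w: "dual_basis E L J w \<theta>" and x: "x \<in> L"
  shows "(\<Oplus>i\<in>I. \<phi> i (x \<otimes> u i)) = (\<Oplus>j\<in>J. \<theta> j (x \<otimes> w j))"
proof -
  note carr = subringE(1)[OF E] subringE(1)[OF L]
  note closed = subringE(6)[OF L]
  have fin: "finite I" "finite J" using u w by (auto simp: dual_basis_def)
  have uL: "u i \<in> L" if "i \<in> I" for i using u that by (auto simp: dual_basis_def Pi_def)
  have wL: "w i \<in> L" if "i \<in> J" for i using w that by (auto simp: dual_basis_def Pi_def)
  have \<phi>E: "\<phi> i y \<in> E" if "i \<in> I" "y \<in> L" for i y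
    using u that by (auto simp: dual_basis_def Pi_def)
  have \<theta>E: "\<theta> i y \<in> E" if "i \<in> J" "y \<in> L" for i y
    using w that by (auto simp: dual_basis_def Pi_def)
  have inR: "y \<in> carrier R" if "y \<in> L" for y using that carr by auto
  have inR': "y \<in> carrier R" if "y \<in> E" for y using that carr by auto
  have expand: "\<phi> i (x \<otimes> u i) = (\<Oplus>j\<in>J. \<theta> j (u i) \<otimes> \<phi> i (x \<otimes> w j))" if i: "i \<in> I" for i
  proof -
    have "x \<otimes> u i = x \<otimes> (\<Oplus>j\<in>J. \<theta> j (u i) \<otimes> w j)"
      using w uL[OF i] by (simp add: dual_basis_def)
    also have "\<dots> = (\<Oplus>j\<in>J. x \<otimes> (\<theta> j (u i) \<otimes> w j))"
      using fin x inR inR' \<theta>E uL[OF i] wL by (subst finsum_rdistr) (auto simp: Pi_def)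
    also have "\<dots> = (\<Oplus>j\<in>J. \<theta> j (u i) \<otimes> (x \<otimes> w j))"
      using x inR inR' \<theta>E uL[OF i] wL by (intro finsum_cong') (auto simp: Pi_def m_lcomm)
    finally have "\<phi> i (x \<otimes> u i) = \<phi> i (\<Oplus>j\<in>J. \<theta> j (u i) \<otimes> (x \<otimes> w j))" by simp
    also have "\<dots> = (\<Oplus>j\<in>J. \<theta> j (u i) \<otimes> \<phi> i (x \<otimes> w j))"
      using u i x closed uL[OF i] wL \<theta>E fin
      by (intro linear_finsum[OF E L EL]) (auto simp: dual_basis_def Pi_def)
    finally show ?thesis .
  qed
  have collect: "\<theta> j (x \<otimes> w j) = (\<Oplus>i\<in>I. \<phi> i (x \<otimes> w j) \<otimes> \<theta> j (u i))" if j: "j \<in> J" for j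
  proof -
    have "\<theta> j (x \<otimes> w j) = \<theta> j (\<Oplus>i\<in>I. \<phi> i (x \<otimes> w j) \<otimes> u i)"
      using u closed[OF x wL[OF j]] by (simp add: dual_basis_def)
    also have "\<dots> = (\<Oplus>i\<in>I. \<phi> i (x \<otimes> w j) \<otimes> \<theta> j (u i))"
      using w j x closed uL wL[OF j] \<phi>E fin
      by (intro linear_finsum[OF E L EL]) (auto simp: dual_basis_def Pi_def)
    finally show ?thesis .
  qed
  have "(\<Oplus>i\<in>I. \<phi> i (x \<otimes> u i)) = (\<Oplus>i\<in>I. \<Oplus>j\<in>J. \<theta> j (u i) \<otimes> \<phi> i (x \<otimes> w j))"
    using expand closed x uL wL \<phi>E \<theta>E inR'
    by (intro finsum_cong') (auto simp: Pi_def intro!: finsum_closed)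
  also have "\<dots> = (\<Oplus>j\<in>J. \<Oplus>i\<in>I. \<theta> j (u i) \<otimes> \<phi> i (x \<otimes> w j))"
    using fin closed x uL wL \<phi>E \<theta>E inR' by (intro finsum_swap) auto
  also have "\<dots> = (\<Oplus>j\<in>J. \<theta> j (x \<otimes> w j))"
    using collect closed x uL wL \<phi>E \<theta>E inR'
    by (intro finsum_cong') (auto simp: Pi_def m_comm intro!: finsum_closed finsum_cong')
  finally show ?thesis .
qed

lemma dual_basis_tower:
  assumes E: "subring E R" and L: "subring L R" and M: "subring M R"
    and EL: "E \<subseteq> L" and LM: "L \<subseteq> M"
    and u: "dual_basis E L I u \<phi>" and w: "dual_basis L M J w \<theta>"
  shows "dual_basis E M (I \<times> J) (\<lambda>p. u (fst p) \<otimes> w (snd p)) (\<lambda>p x. \<phi> (fst p) (\<theta> (snd p) x))"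
proof -
  note carr = subringE(1)[OF E] subringE(1)[OF L] subringE(1)[OF M]
  have fin: "finite I" "finite J" using u w by (auto simp: dual_basis_def)
  have uL: "u i \<in> L" if "i \<in> I" for i using u that by (auto simp: dual_basis_def Pi_def)
  have wM: "w i \<in> M" if "i \<in> J" for i using w that by (auto simp: dual_basis_def Pi_def)
  have \<phi>E: "\<phi> i y \<in> E" if "i \<in> I" "y \<in> L" for i y
    using u that by (auto simp: dual_basis_def Pi_def)
  have \<theta>L: "\<theta> i y \<in> L" if "i \<in> J" "y \<in> M" for i y
    using w that by (auto simp: dual_basis_def Pi_def)
  have "(\<Oplus>p\<in>I \<times> J. \<phi> (fst p) (\<theta> (snd p) x) \<otimes> (u (fst p) \<otimes> w (snd p))) = x" if x: "x \<in> M" for x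
  proof -
    have R: "\<phi> i (\<theta> j x) \<in> carrier R" "u i \<in> carrier R" "w j \<in> carrier R" "\<theta> j x \<in> carrier R"
      if "i \<in> I" "j \<in> J" for i j
      using that x uL wM \<phi>E \<theta>L carr by blast+
    have "(\<Oplus>p\<in>I \<times> J. \<phi> (fst p) (\<theta> (snd p) x) \<otimes> (u (fst p) \<otimes> w (snd p)))
        = (\<Oplus>i\<in>I. \<Oplus>j\<in>J. \<phi> i (\<theta> j x) \<otimes> (u i \<otimes> w j))"
      using fin R by (subst finsum_Times[symmetric]) auto
    also have "\<dots> = (\<Oplus>j\<in>J. \<Oplus>i\<in>I. \<phi> i (\<theta> j x) \<otimes> (u i \<otimes> w j))"
      using fin R by (intro finsum_swap) auto
    also have "\<dots> = (\<Oplus>j\<in>J. \<theta> j x \<otimes> w j)"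
    proof (rule finsum_cong')
      fix j assume j: "j \<in> J"
      have "(\<Oplus>i\<in>I. \<phi> i (\<theta> j x) \<otimes> (u i \<otimes> w j)) = (\<Oplus>i\<in>I. (\<phi> i (\<theta> j x) \<otimes> u i) \<otimes> w j)"
        using R j by (intro finsum_cong') (auto simp: Pi_def m_assoc)
      also have "\<dots> = (\<Oplus>i\<in>I. \<phi> i (\<theta> j x) \<otimes> u i) \<otimes> w j"
        using R j fin wM carr by (subst finsum_ldistr) (auto simp: Pi_def)
      also have "\<dots> = \<theta> j x \<otimes> w j"
        using u \<theta>L[OF j x] by (simp add: dual_basis_def)
      finally show "(\<Oplus>i\<in>I. \<phi> i (\<theta> j x) \<otimes> (u i \<otimes> w j)) = \<theta> j x \<otimes> w j" .
    qed (use carr wM \<theta>L x in \<open>auto simp: Pi_def subset_iff\<close>)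
    also have "\<dots> = x" using w x by (simp add: dual_basis_def)
    finally show ?thesis .
  qed
  moreover have "(\<lambda>p. u (fst p) \<otimes> w (snd p)) \<in> I \<times> J \<rightarrow> M"
    using uL wM subsetD[OF LM] subringE(6)[OF M] by (auto simp: Pi_def)
  ultimately show ?thesis
    using u w fin EL unfolding dual_basis_def by (auto simp: Pi_def subset_iff)
qed

text \<open>
  The functional \<open>\<theta> j\<close> is \<open>L\<close>-linear, so the factor \<open>u i\<close> comes out of it; then the sum over \<open>j\<close>
  moves inside \<open>\<phi> i\<close>. For the dual basis of a tower this is the transitivity of the trace.
\<close>

lemma dual_basis_trace_tower:
  assumes E: "subring E R" and L: "subring L R" and M: "subring M R"
    and EL: "E \<subseteq> L" and LM: "L \<subseteq> M"
    and u: "dual_basis E L I u \<phi>" and w: "dual_basis L M J w \<theta>" and x: "x \<in> M"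
  shows "(\<Oplus>p\<in>I \<times> J. \<phi> (fst p) (\<theta> (snd p) (x \<otimes> (u (fst p) \<otimes> w (snd p)))))
       = (\<Oplus>i\<in>I. \<phi> i ((\<Oplus>j\<in>J. \<theta> j (x \<otimes> w j)) \<otimes> u i))"
proof -
  note carr = subringE(1)[OF E] subringE(1)[OF L] subringE(1)[OF M]
  have fin: "finite I" "finite J" using u w by (auto simp: dual_basis_def)
  have uL: "u i \<in> L" if "i \<in> I" for i using u that by (auto simp: dual_basis_def Pi_def)
  have wM: "w i \<in> M" if "i \<in> J" for i using w that by (auto simp: dual_basis_def Pi_def)
  have \<phi>E: "\<phi> i y \<in> E" if "i \<in> I" "y \<in> L" for i y
    using u that by (auto simp: dual_basis_def Pi_def)
  have \<theta>L: "\<theta> i y \<in> L" if "i \<in> J" "y \<in> M" for i y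
    using w that by (auto simp: dual_basis_def Pi_def)
  have xw: "x \<otimes> w j \<in> M" if "j \<in> J" for j using x wM that subringE(6)[OF M] by auto
  have xR: "x \<in> carrier R" using x carr by auto
  have uR: "u i \<in> carrier R" if "i \<in> I" for i using uL[OF that] carr by auto
  have wR: "w i \<in> carrier R" if "i \<in> J" for i using wM[OF that] carr by auto
  have uw: "x \<otimes> (u i \<otimes> w j) = u i \<otimes> (x \<otimes> w j)" if "i \<in> I" "j \<in> J" for i j
    using xR uR wR that by (simp add: m_lcomm)
  have pull: "\<theta> j (x \<otimes> (u i \<otimes> w j)) = u i \<otimes> \<theta> j (x \<otimes> w j)" if "i \<in> I" "j \<in> J" for i j
    using w uw that uL xw by (auto simp: dual_basis_def)
  have uxM: "x \<otimes> (u i \<otimes> w j) \<in> M" if "i \<in> I" "j \<in> J" for i j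
    using x wM[OF that(2)] subsetD[OF LM uL[OF that(1)]] subringE(6)[OF M] by auto
  have inner: "(\<Oplus>j\<in>J. \<phi> i (\<theta> j (x \<otimes> (u i \<otimes> w j)))) = \<phi> i ((\<Oplus>j\<in>J. \<theta> j (x \<otimes> w j)) \<otimes> u i)"
    if i: "i \<in> I" for i
  proof -
    have \<theta>R: "\<theta> j (x \<otimes> w j) \<in> carrier R" if "j \<in> J" for j
      using \<theta>L[OF that xw[OF that]] carr by auto
    have "(\<Oplus>j\<in>J. \<phi> i (\<theta> j (x \<otimes> (u i \<otimes> w j))))
        = (\<Oplus>j\<in>J. \<one> \<otimes> \<phi> i (\<theta> j (x \<otimes> w j) \<otimes> u i))"
      using \<phi>E \<theta>L xw uL uR i carr pull \<theta>R subringE(6)[OF L]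
      by (intro finsum_cong') (auto simp: Pi_def m_comm subset_iff)
    also have "\<dots> = \<phi> i (\<Oplus>j\<in>J. \<one> \<otimes> (\<theta> j (x \<otimes> w j) \<otimes> u i))"
      using u i \<theta>L xw uL subringE(6)[OF L] fin subringE(3)[OF E]
      by (intro linear_finsum[OF E L EL, symmetric]) (auto simp: dual_basis_def Pi_def)
    also have "(\<Oplus>j\<in>J. \<one> \<otimes> (\<theta> j (x \<otimes> w j) \<otimes> u i)) = (\<Oplus>j\<in>J. \<theta> j (x \<otimes> w j)) \<otimes> u i"
      using fin \<theta>R uR i by (subst finsum_ldistr) (auto simp: Pi_def intro!: finsum_cong')
    finally show ?thesis .
  qed
  have "(\<Oplus>p\<in>I \<times> J. \<phi> (fst p) (\<theta> (snd p) (x \<otimes> (u (fst p) \<otimes> w (snd p)))))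
      = (\<Oplus>i\<in>I. \<Oplus>j\<in>J. \<phi> i (\<theta> j (x \<otimes> (u i \<otimes> w j))))"
    using fin \<phi>E \<theta>L uxM carr by (subst finsum_Times[symmetric]) (auto simp: subset_iff)
  also have "\<dots> = (\<Oplus>i\<in>I. \<phi> i ((\<Oplus>j\<in>J. \<theta> j (x \<otimes> w j)) \<otimes> u i))"
  proof (rule finsum_cong')
    have "(\<Oplus>j\<in>J. \<theta> j (x \<otimes> w j)) \<in> L"
      using \<theta>L xw by (intro finsum_in_subring[OF L]) auto
    then have "\<phi> i ((\<Oplus>j\<in>J. \<theta> j (x \<otimes> w j)) \<otimes> u i) \<in> E" if "i \<in> I" for i
      using that \<phi>E uL subringE(6)[OF L] by blast
    then show "(\<lambda>i. \<phi> i ((\<Oplus>j\<in>J. \<theta> j (x \<otimes> w j)) \<otimes> u i)) \<in> I \<rightarrow> carrier R"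
      using carr by blast
  qed (use inner in auto)
  finally show ?thesis .
qed

end
text \<open>
  The coordinates in a basis, given by a definite description, are linear because sums and
  multiples of coordinate lists are coordinate lists, and these are unique. The last claim makes
  the trace of 1 equal to the dimension.
\<close>

lemma (in cring) basis_dual_basis:
  assumes E: "subfield E R" and L: "subring L R" and b: "is_basis R E L us"
  shows "dual_basis E L {..<length us} (\<lambda>i. us ! i) (\<lambda>i x. coords R E us x ! i)"
    and "\<And>i. i < length us \<Longrightarrow> coords R E us (us ! i) ! i = \<one>"
proof -
  have us: "set us \<subseteq> carrier R" and ind: "independent E us" and span: "Span E us = L"
    using b by (auto simp: is_basis_def)
  note ER = subfieldE(1)[OF E]
  note carr = subringE(1)[OF ER] subringE(1)[OF L]
  have usL: "us ! i \<in> L" if "i < length us" for i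
    using Span_base_incl[OF E us] span that by auto
  have ex1: "\<exists>!cs. set cs \<subseteq> E \<and> length cs = length us \<and> combine cs us = x" if "x \<in> L" for x
    using unique_decomposition[OF E ind] that span by metis
  have co: "set (coords R E us x) \<subseteq> E \<and> length (coords R E us x) = length us
      \<and> combine (coords R E us x) us = x" if "x \<in> L" for x
    using theI'[OF ex1[OF that]] by (simp add: coords_def)
  have uniq: "coords R E us x = cs"
    if "set cs \<subseteq> E" "length cs = length us" "combine cs us = x" "x \<in> L" for cs x
    using ex1[OF that(4)] co[OF that(4)] that by blast
  have coE: "coords R E us x ! i \<in> E" if "x \<in> L" "i < length us" for x i
    using co[OF that(1)] that(2) by (metis nth_mem subsetD)
  have add: "coords R E us (x \<oplus> y) = map2 (\<oplus>) (coords R E us x) (coords R E us y)"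
    if "x \<in> L" "y \<in> L" for x y
  proof (rule uniq)
    show "set (map2 (\<oplus>) (coords R E us x) (coords R E us y)) \<subseteq> E"
      using co[OF that(1)] co[OF that(2)] coE that subringE(7)[OF ER]
      by (auto simp: set_zip)
    show "combine (map2 (\<oplus>) (coords R E us x) (coords R E us y)) us = x \<oplus> y"
      using co[OF that(1)] co[OF that(2)] us carr
      by (subst combine_add[symmetric]) auto
  qed (use co that subringE(7)[OF L] in auto)
  have smult: "coords R E us (c \<otimes> x) = map ((\<otimes>) c) (coords R E us x)"
    if "c \<in> E" "x \<in> L" for c x
  proof (rule uniq)
    show "set (map ((\<otimes>) c) (coords R E us x)) \<subseteq> E"
      using co[OF that(2)] that subringE(6)[OF ER] by auto
    show "combine (map ((\<otimes>) c) (coords R E us x)) us = c \<otimes> x"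
      using co[OF that(2)] us carr that
      by (subst combine_r_distr[symmetric]) auto
    show "c \<otimes> x \<in> L"
      using Span_smult_closed[OF E us] that span by auto
  qed (use co that in auto)
  have sum: "(\<Oplus>i\<in>{..<length us}. coords R E us x ! i \<otimes> us ! i) = x" if "x \<in> L" for x
    using combine_eq_finsum[of "coords R E us x" us] co[OF that] us carr by auto
  show "dual_basis E L {..<length us} (\<lambda>i. us ! i) (\<lambda>i x. coords R E us x ! i)"
    unfolding dual_basis_def using usL coE add smult sum co by auto
  fix i assume i: "i < length us"
  define ds where "ds = map (\<lambda>j. if i = j then \<one> else \<zero>) [0..<length us]"
  have usR: "us ! j \<in> carrier R" if "j < length us" for j using us that by auto
  have "combine ds us = (\<Oplus>j\<in>{..<length us}. ds ! j \<otimes> us ! j)"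
    using us by (intro combine_eq_finsum) (auto simp: ds_def)
  also have "\<dots> = (\<Oplus>j\<in>{..<length us}. if i = j then us ! j else \<zero>)"
    using usR by (intro finsum_cong') (auto simp: ds_def Pi_def)
  also have "\<dots> = us ! i"
    using i usR by (intro finsum_singleton) (auto simp: Pi_def)
  finally have "coords R E us (us ! i) = ds"
    using subringE(2,3)[OF ER] usL[OF i] by (intro uniq) (auto simp: ds_def)
  with i show "coords R E us (us ! i) ! i = \<one>" by (simp add: ds_def)
qed

section \<open>The trace of a finite extension\<close>

context field begin

lemma is_basis_some:
  assumes "subfield E R" "finite_dimension E L"
  shows "is_basis R E L (SOME us. is_basis R E L us)"
proof -
  from assms(2) obtain n where "dimension n E L" by auto
  from exists_base[OF assms(1) this] show ?thesis
    unfolding is_basis_def by (metis (mono_tags, lifting) someI_ex)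
qed

text \<open>
  The trace is defined through an arbitrary choice of basis; this frees it from that choice.
\<close>

lemma field_trace_eq:
  assumes E: "subfield E R" and L: "subfield L R" and "E \<subseteq> L" and "finite_dimension E L"
    and "dual_basis E L I u \<phi>" and "x \<in> L"
  shows "field_trace R E L x = (\<Oplus>i\<in>I. \<phi> i (x \<otimes> u i))"
  using dual_basis_trace_unique[OF subfieldE(1)[OF E] subfieldE(1)[OF L] assms(3)
      basis_dual_basis(1)[OF E subfieldE(1)[OF L] is_basis_some[OF E assms(4)]] assms(5,6)]
  by (simp add: field_trace_def Let_def)

lemma ex_dual_basis:
  assumes E: "subfield E R" and L: "subring L R" and "finite_dimension E L"
  obtains us where "dual_basis E L {..<length us} (\<lambda>i. us ! i) (\<lambda>i x. coords R E us x ! i)"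
    and "\<And>i. i < length us \<Longrightarrow> coords R E us (us ! i) ! i = \<one>"
    and "length us = dim E L"
proof
  let ?us = "SOME us. is_basis R E L us"
  note b = is_basis_some[OF E assms(3)]
  show "dual_basis E L {..<length ?us} (\<lambda>i. ?us ! i) (\<lambda>i x. coords R E ?us x ! i)"
    "\<And>i. i < length ?us \<Longrightarrow> coords R E ?us (?us ! i) ! i = \<one>"
    using basis_dual_basis[OF E L b] by auto
  show "length ?us = dim E L"
    using dimI[OF E dimensionI[OF E]] b unfolding over_def is_basis_def by metis
qed

lemma
  assumes E: "subfield E R" and L: "subfield L R" and EL: "E \<subseteq> L" and fd: "finite_dimension E L"
  shows field_trace_closed: "x \<in> L \<Longrightarrow> field_trace R E L x \<in> E"
    and field_trace_add: "x \<in> L \<Longrightarrow> y \<in> L \<Longrightarrow>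
          field_trace R E L (x \<oplus> y) = field_trace R E L x \<oplus> field_trace R E L y"
    and field_trace_smult: "c \<in> E \<Longrightarrow> x \<in> L \<Longrightarrow>
          field_trace R E L (c \<otimes> x) = c \<otimes> field_trace R E L x"
    and field_trace_base: "c \<in> E \<Longrightarrow> field_trace R E L c = [dim E L] \<cdot> \<one> \<otimes> c"
proof -
  note ER = subfieldE(1)[OF E] and LR = subfieldE(1)[OF L]
  note carr = subringE(1)[OF ER] subringE(1)[OF LR]
  obtain us where b: "dual_basis E L {..<length us} (\<lambda>i. us ! i) (\<lambda>i x. coords R E us x ! i)"
    and one: "\<And>i. i < length us \<Longrightarrow> coords R E us (us ! i) ! i = \<one>"
    and len: "length us = dim E L"
    using ex_dual_basis[OF E LR fd] by blast
  note tr = field_trace_eq[OF E L EL fd b]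
  have usL: "us ! i \<in> L" if "i < length us" for i
    using b that by (auto simp: dual_basis_def Pi_def)
  have usR: "us ! i \<in> carrier R" if "i < length us" for i
    using usL[OF that] carr by auto
  have coE: "coords R E us x ! i \<in> E" if "x \<in> L" "i < length us" for x i
    using b that by (auto simp: dual_basis_def Pi_def)
  have coR: "coords R E us x ! i \<in> carrier R" if "x \<in> L" "i < length us" for x i
    using coE[OF that] carr by auto
  have mL: "x \<otimes> us ! i \<in> L" if "x \<in> L" "i < length us" for x i
    using that usL subringE(6)[OF LR] by auto
  show "field_trace R E L x \<in> E" if "x \<in> L" for x
    unfolding tr[OF that] using coE mL that by (intro finsum_in_subring[OF ER]) auto
  show "field_trace R E L (x \<oplus> y) = field_trace R E L x \<oplus> field_trace R E L y"
    if "x \<in> L" "y \<in> L" for x y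
  proof -
    have R: "x \<in> carrier R" "y \<in> carrier R" using that carr by auto
    have "field_trace R E L (x \<oplus> y)
        = (\<Oplus>i\<in>{..<length us}. coords R E us (x \<otimes> us ! i) ! i \<oplus> coords R E us (y \<otimes> us ! i) ! i)"
      unfolding tr[OF subringE(7)[OF LR that]] using b R usR mL that coR
      by (intro finsum_cong') (auto simp: dual_basis_def Pi_def l_distr)
    then show ?thesis
      unfolding tr[OF that(1)] tr[OF that(2)] using mL coR that
      by (subst finsum_addf[symmetric]) (auto simp: Pi_def)
  qed
  show smult: "field_trace R E L (c \<otimes> x) = c \<otimes> field_trace R E L x"
    if "c \<in> E" "x \<in> L" for c x
  proof -
    have R: "x \<in> carrier R" "c \<in> carrier R" using that carr by auto
    have cL: "c \<in> L" using that EL by auto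
    have "field_trace R E L (c \<otimes> x) = (\<Oplus>i\<in>{..<length us}. c \<otimes> coords R E us (x \<otimes> us ! i) ! i)"
      unfolding tr[OF subringE(6)[OF LR cL that(2)]] using b R usR mL that coR
      by (intro finsum_cong') (auto simp: dual_basis_def Pi_def m_assoc)
    then show ?thesis
      unfolding tr[OF that(2)] using mL coR that R
      by (subst finsum_rdistr) (auto simp: Pi_def)
  qed
  show "field_trace R E L c = [dim E L] \<cdot> \<one> \<otimes> c" if c: "c \<in> E" for c
  proof -
    have oneL: "\<one> \<in> L" using subringE(3)[OF LR] .
    have "field_trace R E L \<one> = (\<Oplus>i\<in>{..<length us}. \<one>)"
      unfolding tr[OF oneL] using one usR by (intro finsum_cong') (auto simp: Pi_def)
    also have "\<dots> = [dim E L] \<cdot> \<one>"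
      using add.finprod_const[of \<one> "{..<length us}"] len by simp
    finally show ?thesis
      using smult[OF c oneL] c carr by (auto simp: m_comm subset_iff)
  qed
qed

lemma field_trace_trans:
  assumes E: "subfield E R" and L: "subfield L R" and M: "subfield M R"
    and EL: "E \<subseteq> L" and LM: "L \<subseteq> M"
    and fEL: "finite_dimension E L" and fLM: "finite_dimension L M" and x: "x \<in> M"
  shows "field_trace R E L (field_trace R L M x) = field_trace R E M x"
proof -
  note ER = subfieldE(1)[OF E] and LR = subfieldE(1)[OF L] and MR = subfieldE(1)[OF M]
  note fEM = telescopic_base_dim(1)[OF E L fEL fLM]
  obtain us where u: "dual_basis E L {..<length us} (\<lambda>i. us ! i) (\<lambda>i x. coords R E us x ! i)"
    using ex_dual_basis[OF E LR fEL] by blast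
  obtain ws where w: "dual_basis L M {..<length ws} (\<lambda>i. ws ! i) (\<lambda>i x. coords R L ws x ! i)"
    using ex_dual_basis[OF L MR fLM] by blast
  show ?thesis
    using field_trace_eq[OF E L EL fEL u field_trace_closed[OF L M LM fLM x]]
      field_trace_eq[OF E M order_trans[OF EL LM] fEM
        dual_basis_tower[OF ER LR MR EL LM u w] x]
      field_trace_eq[OF L M LM fLM w x]
      dual_basis_trace_tower[OF ER LR MR EL LM u w x]
    by simp
qed

lemma field_trace_self:
  assumes "subfield E R" "x \<in> E"
  shows "field_trace R E E x = x"
proof -
  have d: "dimension 1 E E" using dimension_one[OF assms(1)] by simp
  have "dim E E = 1" using dimI[OF assms(1) d] by (simp add: over_def)
  with field_trace_base[OF assms(1,1) subset_refl finite_dimensionI[OF d] assms(2)]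
    assms(2) subfieldE(3)[OF assms(1)]
  show ?thesis by auto
qed

text \<open>
  A basis of \<open>M\<close> over \<open>E\<close> still spans \<open>M\<close> over the larger field \<open>L\<close>.
\<close>

lemma finite_dimension_over_intermediate:
  assumes E: "subfield E R" and L: "subfield L R" and M: "subfield M R"
    and EL: "E \<subseteq> L" and LM: "L \<subseteq> M" and fEM: "finite_dimension E M"
  shows "finite_dimension L M"
proof -
  obtain us where us: "set us \<subseteq> carrier R" "Span E us = M"
    using is_basis_some[OF E fEM] by (auto simp: is_basis_def)
  have usM: "set us \<subseteq> M" using Span_base_incl[OF E us(1)] us(2) by simp
  have "subalgebra L M R"
    using subringE(6)[OF subfieldE(1)[OF M]] LM
    by (intro subalgebra.intro subring.axioms(1)[OF subfieldE(1)[OF M]])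
       (auto simp: subalgebra_axioms_def)
  then have "Span L us \<subseteq> M" by (rule subalgebra_Span_incl[OF L _ usM])
  moreover have "M \<subseteq> Span L us"
  proof
    fix x assume "x \<in> M"
    then obtain cs where "set cs \<subseteq> E" "length cs = length us" "x = combine cs us"
      using Span_mem_iff_length_version[OF E us(1)] us(2) by blast
    then show "x \<in> Span L us"
      using Span_mem_iff_length_version[OF L us(1)] EL by blast
  qed
  ultimately show ?thesis
    using Span_finite_dimension[OF L us(1)] by simp
qed

end

section \<open>Normalized traces and the pairing\<close>

locale char_zero_tower = field R for R :: "('a, 'b) ring_scheme" (structure) +
  fixes F :: "nat \<Rightarrow> 'a set"
  assumes char_zero: "char_zero R" and tower: "extension_tower R F"
begin

text \<open>
  The degree as an element of the field, where it is invertible because the characteristic is 0.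
\<close>

abbreviation deg :: "nat \<Rightarrow> 'a" where "deg n \<equiv> [tower_degree R F n] \<cdot> \<one>"

lemma subfield_tower: "subfield (F n) R"
  using tower by (auto simp: extension_tower_def)

lemma subring_tower: "subring (F n) R"
  using subfieldE(1)[OF subfield_tower] .

lemma tower_mono: "n \<le> m \<Longrightarrow> F n \<subseteq> F m"
  using tower lift_Suc_mono_le[of F n m] by (auto simp: extension_tower_def)

lemma tower_carrier: "x \<in> F n \<Longrightarrow> x \<in> carrier R"
  using subringE(1)[OF subring_tower] by auto

lemma finite_dimension_tower: "n \<le> m \<Longrightarrow> finite_dimension (F n) (F m)"
  using tower finite_dimension_over_intermediate[OF subfield_tower subfield_tower subfield_tower
      tower_mono[of 0 n] tower_mono[of n m]]
  by (auto simp: extension_tower_def)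

lemma tower_degree_mult:
  "n \<le> m \<Longrightarrow> tower_degree R F m = tower_degree R F n * dim (F n) (F m)"
  using telescopic_base_dim(2)[OF subfield_tower subfield_tower finite_dimension_tower[of 0 n]
      finite_dimension_tower[of n m]]
  by (simp add: tower_degree_def over_def)

lemma tower_degree_pos: "tower_degree R F n > 0"
proof (rule ccontr)
  assume "\<not> ?thesis"
  then have "dimension 0 (F 0) (F n)"
    using finite_dimensionE[OF subfield_tower finite_dimension_tower[of 0 n]]
    by (simp add: tower_degree_def over_def)
  then have "F n = {\<zero>}" using dimension_zero[OF subfield_tower] by simp
  then show False using subringE(3)[OF subring_tower[of n]] by simp
qed

lemma nat_pos_in_tower:
  assumes "(k::nat) > 0"
  shows "[k] \<cdot> \<one> \<in> F n - {\<zero>}" "inv ([k] \<cdot> \<one>) \<in> F n - {\<zero>}"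
proof -
  have "[j] \<cdot> \<one> \<in> F n" for j :: nat
    by (induction j)
      (auto simp: subringE(2)[OF subring_tower] intro!: subringE(3,7)[OF subring_tower])
  with assms show *: "[k] \<cdot> \<one> \<in> F n - {\<zero>}" using char_zero by (auto simp: char_zero_def)
  show "inv ([k] \<cdot> \<one>) \<in> F n - {\<zero>}" using subfield_m_inv(1)[OF subfield_tower *] .
qed

lemma deg_unit: "deg n \<in> carrier R" "inv (deg n) \<in> carrier R" "deg n \<otimes> inv (deg n) = \<one>"
  using nat_pos_in_tower[OF tower_degree_pos, of n 0] tower_carrier
    subfield_m_inv(2)[OF subfield_tower nat_pos_in_tower(1)[OF tower_degree_pos]]
  by auto

text \<open>
  The trace from \<open>F m'\<close> down to \<open>F m\<close> multiplies \<open>x \<in> F m\<close> by the relative degree, which the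
  quotient of the two normalizing factors cancels.
\<close>

lemma tower_trace_scaling:
  assumes "n \<le> m" "m \<le> m'" and x: "x \<in> F m"
  shows "inv (deg m) \<otimes> field_trace R (F n) (F m) x = inv (deg m') \<otimes> field_trace R (F n) (F m') x"
proof -
  define d where "d = [dim (F m) (F m')] \<cdot> \<one>"
  let ?t = "field_trace R (F n) (F m) x"
  have d0: "dim (F m) (F m') > 0"
    using tower_degree_mult[OF assms(2)] tower_degree_pos[of m'] by (metis gr0I mult_0_right less_irrefl)
  have dF: "d \<in> F n" and dR: "d \<in> carrier R"
    unfolding d_def using nat_pos_in_tower[OF d0] tower_carrier by blast+
  note fld = subfield_tower
  have tF: "?t \<in> F n"
    using field_trace_closed[OF fld fld tower_mono finite_dimension_tower x] assms by simp
  then have tR: "?t \<in> carrier R" by (rule tower_carrier)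
  have "field_trace R (F n) (F m') x = field_trace R (F n) (F m) (field_trace R (F m) (F m') x)"
    using assms subsetD[OF tower_mono[OF assms(2)] x]
    by (intro field_trace_trans[symmetric] fld tower_mono finite_dimension_tower) auto
  also have "field_trace R (F m) (F m') x = d \<otimes> x"
    unfolding d_def using assms by (intro field_trace_base fld tower_mono finite_dimension_tower) auto
  also have "field_trace R (F n) (F m) (d \<otimes> x) = d \<otimes> ?t"
    using assms dF by (intro field_trace_smult fld tower_mono finite_dimension_tower) auto
  finally have 1: "field_trace R (F n) (F m') x = d \<otimes> ?t" .
  have degm': "deg m' = deg m \<otimes> d"
    using tower_degree_mult[OF assms(2)] by (simp add: d_def add_pow_rdistr add.nat_pow_pow)
  have "inv (deg m) \<otimes> ?t = inv (deg m) \<otimes> ((inv (deg m') \<otimes> deg m') \<otimes> ?t)"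
    using deg_unit tR by (simp add: m_comm)
  also have "\<dots> = inv (deg m) \<otimes> ((inv (deg m') \<otimes> (deg m \<otimes> d)) \<otimes> ?t)"
    using degm' by simp
  also have "\<dots> = (deg m \<otimes> inv (deg m)) \<otimes> (inv (deg m') \<otimes> (d \<otimes> ?t))"
    using deg_unit(1,2)[of m] deg_unit(1,2)[of m'] tR dR by (simp add: m_ac)
  finally show ?thesis using 1 deg_unit tR dR by simp
qed

text \<open>
  The definition of the normalized trace uses the least admissible level. Working with any level
  \<open>m\<close> instead, the case \<open>x \<in> F n\<close> included, makes the map visibly linear.
\<close>

lemma normalized_trace_eq:
  assumes nm: "n \<le> m" and x: "x \<in> F m"
  shows "normalized_trace R F n x = deg n \<otimes> (inv (deg m) \<otimes> field_trace R (F n) (F m) x)"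
proof (cases "x \<in> F n")
  case True
  have "deg n \<otimes> (inv (deg m) \<otimes> field_trace R (F n) (F m) x) = deg n \<otimes> (inv (deg n) \<otimes> x)"
    using tower_trace_scaling[OF order_refl nm True] field_trace_self[OF subfield_tower True] by simp
  also have "\<dots> = x"
    using deg_unit[of n] tower_carrier[OF True] by (simp flip: m_assoc)
  finally show ?thesis using True by (simp add: normalized_trace_def)
next
  case False
  define \<nu> where "\<nu> = (LEAST \<nu>. n < \<nu> \<and> x \<in> F \<nu>)"
  have m: "n < m \<and> x \<in> F m" using nm x False by (metis le_neq_implies_less)
  have \<nu>: "n < \<nu> \<and> x \<in> F \<nu>" unfolding \<nu>_def using m by (rule LeastI)
  have "\<nu> \<le> m" unfolding \<nu>_def using m by (rule Least_le)
  with \<nu> have eq: "inv (deg \<nu>) \<otimes> field_trace R (F n) (F \<nu>) x = inv (deg m) \<otimes> field_trace R (F n) (F m) x"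
    by (intro tower_trace_scaling) auto
  have "field_trace R (F n) (F \<nu>) x \<in> carrier R"
    using field_trace_closed[OF subfield_tower subfield_tower tower_mono finite_dimension_tower] \<nu>
    by (intro tower_carrier[of _ n]) auto
  then show ?thesis
    using False deg_unit[of n] deg_unit[of \<nu>]
    unfolding normalized_trace_def Let_def \<nu>_def[symmetric] eq[symmetric]
    by (simp add: m_assoc)
qed

text \<open>
  As \<open>y n\<close> is a normalized trace of \<open>y m\<close> and the trace to \<open>F n\<close> is \<open>F n\<close>-linear, \<open>a * y n\<close> is the
  normalized trace of \<open>a * y m\<close>; transitivity of the trace gives the claim.
\<close>

lemma tower_pairing_step:
  assumes y: "y \<in> proj_limit R F" and a: "a \<in> F n" and nm: "n \<le> m"
  shows "normalized_trace R F 0 (a \<otimes> y n) = normalized_trace R F 0 (a \<otimes> y m)"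
proof (cases "n = m")
  case False
  then have lt: "n < m" using nm by simp
  note fld = subfield_tower
  let ?t = "\<lambda>i j. field_trace R (F i) (F j)"
  have yF: "y i \<in> F i" for i using y by (auto simp: proj_limit_def)
  have aR: "a \<in> carrier R" using a tower_carrier by blast
  have am: "a \<in> F m" using subsetD[OF tower_mono[OF nm] a] .
  have aym: "a \<otimes> y m \<in> F m" using am yF subringE(6)[OF subring_tower] by blast
  have tF: "?t n m z \<in> F n" if "z \<in> F m" for z
    using that nm by (intro field_trace_closed fld tower_mono finite_dimension_tower) auto
  have tR: "?t n m z \<in> carrier R" if "z \<in> F m" for z using tower_carrier tF[OF that] .
  let ?c = "deg n \<otimes> inv (deg m)"
  have cF: "?c \<in> F i" for i
    using nat_pos_in_tower[OF tower_degree_pos] subringE(6)[OF subring_tower] by blast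
  have cR: "?c \<in> carrier R" using tower_carrier cF[of 0] .
  have yn: "y n = ?c \<otimes> ?t n m (y m)"
    using y lt normalized_trace_eq[OF nm yF] deg_unit[of n] deg_unit[of m] tR[OF yF]
    by (auto simp: proj_limit_def m_assoc)
  have "a \<otimes> y n = ?c \<otimes> (a \<otimes> ?t n m (y m))"
    unfolding yn using aR cR tR[OF yF] by (rule m_lcomm)
  also have "a \<otimes> ?t n m (y m) = ?t n m (a \<otimes> y m)"
    using nm a yF by (intro field_trace_smult[symmetric] fld tower_mono finite_dimension_tower) auto
  finally have ayn: "a \<otimes> y n = ?c \<otimes> ?t n m (a \<otimes> y m)" .
  have aynF: "a \<otimes> y n \<in> F n" using a yF subringE(6)[OF subring_tower] by blast
  have "?t 0 n (a \<otimes> y n) = ?c \<otimes> ?t 0 n (?t n m (a \<otimes> y m))"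
    unfolding ayn using tF[OF aym] cF
    by (intro field_trace_smult fld tower_mono finite_dimension_tower) auto
  also have "?t 0 n (?t n m (a \<otimes> y m)) = ?t 0 m (a \<otimes> y m)"
    using nm aym by (intro field_trace_trans fld tower_mono finite_dimension_tower) auto
  finally have t: "?t 0 n (a \<otimes> y n) = ?c \<otimes> ?t 0 m (a \<otimes> y m)" .
  have T: "?t 0 m (a \<otimes> y m) \<in> carrier R"
    using field_trace_closed[OF fld fld tower_mono finite_dimension_tower aym, of 0]
    by (intro tower_carrier[of _ 0]) auto
  have "inv (deg n) \<otimes> (?c \<otimes> ?t 0 m (a \<otimes> y m))
      = (deg n \<otimes> inv (deg n)) \<otimes> (inv (deg m) \<otimes> ?t 0 m (a \<otimes> y m))"
    using deg_unit(1,2)[of n] deg_unit(1,2)[of m] T by (simp add: m_ac)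
  also have "\<dots> = inv (deg m) \<otimes> ?t 0 m (a \<otimes> y m)"
    using deg_unit[of n] deg_unit(2)[of m] T by simp
  finally show ?thesis
    by (simp add: normalized_trace_eq[OF le0 aynF] normalized_trace_eq[OF le0 aym] t)
qed simp

lemma tower_pairing_eq:
  assumes "y \<in> proj_limit R F" "a \<in> F n"
  shows "tower_pairing R F a y = normalized_trace R F 0 (a \<otimes> y n)"
  unfolding tower_pairing_def
  using assms by (intro tower_pairing_step) (auto intro: LeastI Least_le)

lemma tower_pairing_closed:
  assumes y: "y \<in> proj_limit R F" and "a \<in> carrier R"
  shows "tower_pairing R F a y \<in> F 0"
proof -
  obtain n where a: "a \<in> F n" using assms tower by (auto simp: extension_tower_def)
  have ay: "a \<otimes> y n \<in> F n" using a y subringE(6)[OF subring_tower] by (auto simp: proj_limit_def)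
  have "field_trace R (F 0) (F n) (a \<otimes> y n) \<in> F 0"
    using ay by (intro field_trace_closed subfield_tower tower_mono finite_dimension_tower) auto
  then show ?thesis
    unfolding tower_pairing_eq[OF y a] normalized_trace_eq[OF le0 ay]
    using nat_pos_in_tower[OF tower_degree_pos] subringE(6)[OF subring_tower] by blast
qed

text \<open>
  Additivity holds because both summands can be paired with \<open>y\<close> at one common level.
\<close>

lemma tower_pairing_add:
  assumes y: "y \<in> proj_limit R F" and "a \<in> carrier R" "b \<in> carrier R"
  shows "tower_pairing R F (a \<oplus> b) y = tower_pairing R F a y \<oplus> tower_pairing R F b y"
proof -
  obtain i j where "a \<in> F i" "b \<in> F j" using assms tower by (auto simp: extension_tower_def)
  then obtain n where a: "a \<in> F n" and b: "b \<in> F n"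
    using tower_mono[of i "max i j"] tower_mono[of j "max i j"] by auto
  have yF: "y n \<in> F n" using y by (auto simp: proj_limit_def)
  have ab: "a \<oplus> b \<in> F n" using subringE(7)[OF subring_tower a b] .
  have ay: "a \<otimes> y n \<in> F n" and byn: "b \<otimes> y n \<in> F n" and aby: "(a \<oplus> b) \<otimes> y n \<in> F n"
    using a b ab yF subringE(6)[OF subring_tower] by auto
  have tR: "field_trace R (F 0) (F n) z \<in> carrier R" if "z \<in> F n" for z
    using that field_trace_closed[OF subfield_tower subfield_tower tower_mono finite_dimension_tower, of 0 n z]
    by (intro tower_carrier[of _ 0]) auto
  have "field_trace R (F 0) (F n) ((a \<oplus> b) \<otimes> y n)
      = field_trace R (F 0) (F n) (a \<otimes> y n) \<oplus> field_trace R (F 0) (F n) (b \<otimes> y n)"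
    using a b yF ay byn
    by (subst field_trace_add[OF subfield_tower subfield_tower tower_mono finite_dimension_tower, symmetric])
       (auto simp: l_distr tower_carrier)
  then show ?thesis
    unfolding tower_pairing_eq[OF y a] tower_pairing_eq[OF y b] tower_pairing_eq[OF y ab]
      normalized_trace_eq[OF le0 ay] normalized_trace_eq[OF le0 byn] normalized_trace_eq[OF le0 aby]
    using tR ay byn deg_unit(1,2) by (simp add: r_distr)
qed

end

section \<open>Non-Archimedean absolute values on a field\<close>

lemma (in field)
  assumes "nonarch_absval R (carrier R) v"
  shows absval_nonneg: "x \<in> carrier R \<Longrightarrow> 0 \<le> v x"
    and absval_eq_0: "x \<in> carrier R \<Longrightarrow> v x = 0 \<longleftrightarrow> x = \<zero>"
    and absval_mult: "x \<in> carrier R \<Longrightarrow> y \<in> carrier R \<Longrightarrow> v (x \<otimes> y) = v x * v y"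
    and absval_add: "x \<in> carrier R \<Longrightarrow> y \<in> carrier R \<Longrightarrow> v (x \<oplus> y) \<le> max (v x) (v y)"
    and absval_one: "v \<one> = 1"
    and absval_uminus: "x \<in> carrier R \<Longrightarrow> v (\<ominus> x) = v x"
    and absval_minus: "x \<in> carrier R \<Longrightarrow> y \<in> carrier R \<Longrightarrow> v (x \<ominus> y) \<le> max (v x) (v y)"
    and absval_minus_commute: "x \<in> carrier R \<Longrightarrow> y \<in> carrier R \<Longrightarrow> v (x \<ominus> y) = v (y \<ominus> x)"
    and absval_inv: "x \<in> carrier R \<Longrightarrow> x \<noteq> \<zero> \<Longrightarrow> v (inv x) = 1 / v x"
    and absval_pow: "x \<in> carrier R \<Longrightarrow> v (x [^] (n::nat)) = v x ^ n"
proof -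
  show nonneg: "0 \<le> v x" if "x \<in> carrier R" for x
    using assms that by (auto simp: nonarch_absval_def)
  show eq0: "v x = 0 \<longleftrightarrow> x = \<zero>" if "x \<in> carrier R" for x
    using assms that by (auto simp: nonarch_absval_def)
  show mult: "v (x \<otimes> y) = v x * v y" if "x \<in> carrier R" "y \<in> carrier R" for x y
    using assms that by (auto simp: nonarch_absval_def)
  show add: "v (x \<oplus> y) \<le> max (v x) (v y)" if "x \<in> carrier R" "y \<in> carrier R" for x y
    using assms that by (auto simp: nonarch_absval_def)
  show one: "v \<one> = 1"
    using mult[of \<one> \<one>] eq0[of \<one>] by auto
  \<comment> \<open>The value of \<open>-1\<close> is nonnegative with square 1.\<close>
  have "v (\<ominus> \<one>) * v (\<ominus> \<one>) = 1"
    using mult[of "\<ominus> \<one>" "\<ominus> \<one>"] one by (simp add: l_minus)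
  then have m1: "v (\<ominus> \<one>) = 1"
    using nonneg[of "\<ominus> \<one>"] by (simp add: power2_eq_1_iff flip: power2_eq_square)
  show uminus: "v (\<ominus> x) = v x" if "x \<in> carrier R" for x
    using mult[of "\<ominus> \<one>" x] m1 that by (simp add: l_minus)
  show "v (x \<ominus> y) \<le> max (v x) (v y)" if "x \<in> carrier R" "y \<in> carrier R" for x y
    using add[of x "\<ominus> y"] uminus[OF that(2)] that by (simp add: minus_eq)
  show "v (x \<ominus> y) = v (y \<ominus> x)" if "x \<in> carrier R" "y \<in> carrier R" for x y
    using uminus[of "x \<ominus> y"] that by (simp add: minus_eq minus_add a_comm)
  show "v (inv x) = 1 / v x" if "x \<in> carrier R" "x \<noteq> \<zero>" for x
  proof -
    have "x \<in> Units R" using that by (simp add: field_Units)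
    then have "v x * v (inv x) = 1" using mult[of x "inv x"] one that by simp
    then show ?thesis using eq0[of x] that by (simp add: field_simps)
  qed
  show "v (x [^] (n::nat)) = v x ^ n" if "x \<in> carrier R" for x
    using that by (induction n) (auto simp: one mult mult.commute)
qed

lemma (in field) absval_finsum_le:
  assumes v: "nonarch_absval R (carrier R) v" and "0 \<le> c"
    and "\<And>i. i \<in> I \<Longrightarrow> f i \<in> carrier R" "\<And>i. i \<in> I \<Longrightarrow> v (f i) \<le> c"
  shows "v (\<Oplus>i\<in>I. f i) \<le> c"
  using assms(3,4)
proof (induction I rule: infinite_finite_induct)
  case (insert x I)
  then have "v (\<Oplus>i\<in>insert x I. f i) \<le> max (v (f x)) (v (\<Oplus>i\<in>I. f i))"
    by (subst finsum_insert) (auto simp: Pi_def intro!: absval_add[OF v])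
  with insert show ?case by fastforce
qed (use absval_eq_0[OF v zero_closed] \<open>0 \<le> c\<close> in \<open>auto simp: finsum_infinite\<close>)

lemma (in field) absval_Metric_space:
  assumes v: "nonarch_absval R (carrier R) v" and k: "subring k R"
  shows "Metric_space k (absval_dist R k v)"
proof
  note kR = subsetD[OF subringE(1)[OF k]]
  fix x y z
  show "0 \<le> absval_dist R k v x y"
    using absval_nonneg[OF v] kR by (simp add: absval_dist_def)
  show "absval_dist R k v x y = absval_dist R k v y x"
    using absval_minus_commute[OF v] kR by (simp add: absval_dist_def)
  show "absval_dist R k v x y = 0 \<longleftrightarrow> x = y" if "x \<in> k" "y \<in> k"
    using that absval_eq_0[OF v, of "x \<ominus> y"] kR by (simp add: absval_dist_def)
  show "absval_dist R k v x z \<le> absval_dist R k v x y + absval_dist R k v y z"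
    if "x \<in> k" "y \<in> k" "z \<in> k"
  proof -
    have R: "x \<in> carrier R" "y \<in> carrier R" "z \<in> carrier R" using that kR by auto
    have "x \<ominus> z = (x \<ominus> y) \<oplus> (y \<ominus> z)"
      using R by (simp add: minus_eq a_assoc l_neg r_neg1 r_neg2)
    then have "v (x \<ominus> z) \<le> max (v (x \<ominus> y)) (v (y \<ominus> z))"
      using R absval_add[OF v, of "x \<ominus> y" "y \<ominus> z"] by simp
    then show ?thesis
      using that R absval_nonneg[OF v, of "x \<ominus> y"] absval_nonneg[OF v, of "y \<ominus> z"]
      by (simp add: absval_dist_def)
  qed
qed

text \<open>
  By the ultrametric inequality the whole tail after \<open>n\<close> stays within \<open>r ^ n\<close> of \<open>s n\<close>, so the
  distance to the limit obeys the same bound as a single step.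
\<close>

lemma (in field) complete_limit_geometric:
  assumes v: "nonarch_absval R (carrier R) v" and k: "subring k R"
    and complete: "Metric_space.mcomplete k (absval_dist R k v)"
    and s: "\<And>n. s n \<in> k" and r: "0 < r" "r < 1"
    and step: "\<And>n. v (s (Suc n) \<ominus> s n) \<le> r ^ n"
  shows "\<exists>l\<in>k. \<forall>n. v (s n \<ominus> l) \<le> r ^ n"
proof -
  interpret Metric_space k "absval_dist R k v" using absval_Metric_space[OF v k] .
  note kR = subsetD[OF subringE(1)[OF k]]
  have sR: "s n \<in> carrier R" for n using s kR by blast
  have tail: "v (s (n + d) \<ominus> s n) \<le> r ^ n" for n d
  proof (induction d)
    case 0
    then show ?case using absval_eq_0[OF v, of "s n \<ominus> s n"] sR r by (simp add: minus_eq r_neg)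
  next
    case (Suc d)
    have "s (n + Suc d) \<ominus> s n = (s (Suc (n + d)) \<ominus> s (n + d)) \<oplus> (s (n + d) \<ominus> s n)"
      using sR by (simp add: minus_eq a_assoc r_neg1)
    then have "v (s (n + Suc d) \<ominus> s n) \<le> max (v (s (Suc (n + d)) \<ominus> s (n + d))) (v (s (n + d) \<ominus> s n))"
      using sR absval_add[OF v] by simp
    moreover have "r ^ (n + d) \<le> r ^ n" using r by (intro power_decreasing) auto
    ultimately show ?case using Suc step[of "n + d"] by auto
  qed
  have close: "v (s m \<ominus> s n) \<le> r ^ N" if "N \<le> m" "N \<le> n" for m n N
  proof -
    have "s m \<ominus> s n = (s m \<ominus> s N) \<oplus> (s N \<ominus> s n)"
      using sR by (simp add: minus_eq a_assoc r_neg1)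
    then have "v (s m \<ominus> s n) \<le> max (v (s m \<ominus> s N)) (v (s N \<ominus> s n))"
      using sR absval_add[OF v] by simp
    moreover have "v (s N \<ominus> s n) = v (s n \<ominus> s N)"
      using sR absval_minus_commute[OF v] by blast
    ultimately show ?thesis
      using tail[of N "m - N"] tail[of N "n - N"] that by simp
  qed
  have "MCauchy s"
    unfolding MCauchy_def
  proof (intro conjI allI impI)
    fix e :: real assume "e > 0"
    then obtain N where "r ^ N < e" using r real_arch_pow_inv by blast
    then show "\<exists>N. \<forall>n n'. N \<le> n \<longrightarrow> N \<le> n' \<longrightarrow> absval_dist R k v (s n) (s n') < e"
      using close s by (intro exI[of _ N]) (auto simp: absval_dist_def intro: le_less_trans)
  qed (use s in auto)
  then obtain l where "limitin mtopology s l sequentially"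
    using complete unfolding mcomplete_def by blast
  then have l: "l \<in> k" and lim: "\<And>e. e > 0 \<Longrightarrow> \<exists>N. \<forall>n\<ge>N. v (s n \<ominus> l) < e"
    using s unfolding limit_metric_sequentially by (auto simp: absval_dist_def)
  have "v (s n \<ominus> l) \<le> r ^ n" for n
  proof -
    obtain N where N: "\<forall>m\<ge>N. v (s m \<ominus> l) < r ^ n" using lim[of "r ^ n"] r by auto
    define m where "m = max N n"
    have "s n \<ominus> l = (s n \<ominus> s m) \<oplus> (s m \<ominus> l)"
      using sR kR[OF l] by (simp add: minus_eq a_assoc r_neg1)
    then have "v (s n \<ominus> l) \<le> max (v (s n \<ominus> s m)) (v (s m \<ominus> l))"
      using sR kR[OF l] absval_add[OF v] by simp
    then show ?thesis using N close[of n n m] by (simp add: m_def) (smt (verit) max.cobounded1)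
  qed
  with l show ?thesis by blast
qed

section \<open>Finite nets of integers and separated sequences\<close>

text \<open>
  Successive approximation: the remainder of step \<open>n\<close>, divided by \<open>p ^ n\<close>, is integral, hence
  within \<open>v p\<close> of some \<open>b0 \<in> B\<close>, and adding \<open>p ^ n\<close> to the coefficient of \<open>b0\<close> improves the
  approximation by a factor \<open>v p\<close>. The coefficients move by at most \<open>v p ^ n\<close>, which makes
  them converge.
\<close>

lemma (in field) approximations_by_finite_net:
  assumes v: "nonarch_absval R (carrier R) v" and k: "subfield k R"
    and p: "p \<in> k" "0 < v p" and B: "finite B" "B \<subseteq> carrier R"
    and net: "\<And>x. x \<in> carrier R \<Longrightarrow> v x \<le> 1 \<Longrightarrow> \<exists>b\<in>B. v (x \<ominus> b) \<le> v p"
    and x: "x \<in> carrier R" "v x \<le> 1"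
  shows "\<exists>s. \<forall>n. (s n \<in> B \<rightarrow> k \<and> v (x \<ominus> (\<Oplus>b\<in>B. s n b \<otimes> b)) \<le> v p ^ n) \<and>
     (\<forall>b\<in>B. v (s (Suc n) b \<ominus> s n b) \<le> v p ^ n)"
proof (rule dependent_nat_choice)
  note kring = subfieldE(1)[OF k]
  note kR = subsetD[OF subringE(1)[OF kring]]
  have B_R: "b \<in> carrier R" if "b \<in> B" for b using B that by auto
  have "(\<Oplus>b\<in>B. \<zero> \<otimes> b) = (\<Oplus>b\<in>B. \<zero>)"
    using B_R by (intro finsum_cong') auto
  then show "\<exists>c. c \<in> B \<rightarrow> k \<and> v (x \<ominus> (\<Oplus>b\<in>B. c b \<otimes> b)) \<le> v p ^ 0"
    using x subringE(2)[OF kring] by (intro exI[of _ "\<lambda>_. \<zero>"]) (simp add: minus_eq)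
  fix c n assume c: "c \<in> B \<rightarrow> k \<and> v (x \<ominus> (\<Oplus>b\<in>B. c b \<otimes> b)) \<le> v p ^ n"
  define S where "S = (\<Oplus>b\<in>B. c b \<otimes> b)"
  have cR: "c b \<in> carrier R" if "b \<in> B" for b using c that kR by blast
  have SR: "S \<in> carrier R" unfolding S_def using cR B_R by (intro finsum_closed) auto
  have pR: "p \<in> carrier R" using p kR by blast
  define q where "q = p [^] n"
  have qR: "q \<in> carrier R" and vq: "v q = v p ^ n"
    using pR absval_pow[OF v pR] by (auto simp: q_def)
  then have q0: "q \<noteq> \<zero>" using p absval_eq_0[OF v qR] by auto
  then have qU: "q \<in> Units R" using qR by (simp add: field_Units)
  have qk: "q \<in> k"
    unfolding q_def by (induction n) (auto intro: subringE(3,6)[OF kring] p)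
  define z where "z = inv q \<otimes> (x \<ominus> S)"
  have zR: "z \<in> carrier R" using x SR qU by (simp add: z_def)
  have "v z = v (x \<ominus> S) / v p ^ n"
    using absval_mult[OF v] absval_inv[OF v qR q0] x SR qU vq by (simp add: z_def)
  then have "v z \<le> 1" using c p by (simp add: S_def)
  then obtain b0 where b0: "b0 \<in> B" "v (z \<ominus> b0) \<le> v p" using net[OF zR] by blast
  define d where "d b = (if b0 = b then q else \<zero>)" for b
  define c' where "c' b = c b \<oplus> d b" for b
  have dR: "d b \<in> carrier R" and dk: "d b \<in> k" for b
    using qR qk subringE(2)[OF kring] by (auto simp: d_def)
  have "(\<Oplus>b\<in>B. c' b \<otimes> b) = (\<Oplus>b\<in>B. c b \<otimes> b \<oplus> d b \<otimes> b)"
    using cR dR B_R by (intro finsum_cong') (auto simp: c'_def l_distr)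
  also have "\<dots> = S \<oplus> (\<Oplus>b\<in>B. d b \<otimes> b)"
    unfolding S_def using cR dR B_R by (intro finsum_addf) auto
  also have "(\<Oplus>b\<in>B. d b \<otimes> b) = (\<Oplus>b\<in>B. if b0 = b then q \<otimes> b else \<zero>)"
    using qR B_R by (intro finsum_cong') (auto simp: d_def)
  also have "\<dots> = q \<otimes> b0"
    using b0 B qR B_R by (intro finsum_singleton) auto
  finally have S': "(\<Oplus>b\<in>B. c' b \<otimes> b) = S \<oplus> q \<otimes> b0" .
  have b0R: "b0 \<in> carrier R" using b0 B_R by blast
  have "q \<otimes> z = x \<ominus> S"
    unfolding z_def using qU qR x SR by (simp flip: m_assoc)
  then have "x \<ominus> (S \<oplus> q \<otimes> b0) = q \<otimes> z \<ominus> q \<otimes> b0"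
    using x SR qR b0R by (simp add: minus_eq minus_add a_assoc)
  also have "\<dots> = q \<otimes> (z \<ominus> b0)"
    using qR zR b0R by (simp add: minus_eq r_distr r_minus)
  finally have "v (x \<ominus> (S \<oplus> q \<otimes> b0)) = v p ^ n * v (z \<ominus> b0)"
    using absval_mult[OF v] vq qR zR b0R by simp
  also have "\<dots> \<le> v p ^ n * v p"
    using b0 p by (intro mult_left_mono) auto
  finally have approx: "v (x \<ominus> (\<Oplus>b\<in>B. c' b \<otimes> b)) \<le> v p ^ Suc n"
    unfolding S' by (simp add: mult.commute)
  have "v (c' b \<ominus> c b) \<le> v p ^ n" if "b \<in> B" for b
  proof -
    have "c' b \<ominus> c b = d b"
      unfolding c'_def a_comm[OF cR[OF that] dR]
      using cR[OF that] dR[of b] by (simp add: minus_eq a_assoc r_neg)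
    then show ?thesis
      using vq absval_eq_0[OF v, of \<zero>] p by (auto simp: d_def)
  qed
  moreover have "c' \<in> B \<rightarrow> k"
    using c dk subringE(7)[OF kring] by (auto simp: c'_def Pi_def)
  ultimately show "\<exists>c'. (c' \<in> B \<rightarrow> k \<and> v (x \<ominus> (\<Oplus>b\<in>B. c' b \<otimes> b)) \<le> v p ^ Suc n) \<and>
     (\<forall>b\<in>B. v (c' b \<ominus> c b) \<le> v p ^ n)"
    using approx by blast
qed

text \<open>
  The coefficients of the successive approximations converge in the complete field \<open>k\<close>, and \<open>x\<close>
  is the combination of the \<open>b\<close> with the limits as coefficients.
\<close>

lemma (in field) integral_in_Span_of_finite_net:
  assumes v: "nonarch_absval R (carrier R) v" and k: "subfield k R"
    and complete: "Metric_space.mcomplete k (absval_dist R k v)"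
    and p: "p \<in> k" "0 < v p" "v p < 1"
    and bs: "distinct bs" "set bs \<subseteq> carrier R" "\<And>b. b \<in> set bs \<Longrightarrow> v b \<le> 1"
    and net: "\<And>x. x \<in> carrier R \<Longrightarrow> v x \<le> 1 \<Longrightarrow> \<exists>b\<in>set bs. v (x \<ominus> b) \<le> v p"
    and x: "x \<in> carrier R" "v x \<le> 1"
  shows "x \<in> Span k bs"
proof -
  note kring = subfieldE(1)[OF k]
  note kR = subsetD[OF subringE(1)[OF kring]]
  have bR: "b \<in> carrier R" if "b \<in> set bs" for b using bs that by auto
  have "\<exists>s. \<forall>n. (s n \<in> set bs \<rightarrow> k \<and> v (x \<ominus> (\<Oplus>b\<in>set bs. s n b \<otimes> b)) \<le> v p ^ n) \<and>
     (\<forall>b\<in>set bs. v (s (Suc n) b \<ominus> s n b) \<le> v p ^ n)"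
    by (rule approximations_by_finite_net[OF v k p(1,2) finite_set bs(2) net x])
  then obtain s where s: "\<And>n. s n \<in> set bs \<rightarrow> k"
    and approx: "\<And>n. v (x \<ominus> (\<Oplus>b\<in>set bs. s n b \<otimes> b)) \<le> v p ^ n"
    and step: "\<And>n b. b \<in> set bs \<Longrightarrow> v (s (Suc n) b \<ominus> s n b) \<le> v p ^ n"
    by blast
  have "\<forall>b\<in>set bs. \<exists>l\<in>k. \<forall>n. v (s n b \<ominus> l) \<le> v p ^ n"
    using s step p by (intro ballI complete_limit_geometric[OF v kring complete]) auto
  then obtain l where l: "\<And>b. b \<in> set bs \<Longrightarrow> l b \<in> k"
    and lim: "\<And>b n. b \<in> set bs \<Longrightarrow> v (s n b \<ominus> l b) \<le> v p ^ n"
    by metis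
  define y where "y = (\<Oplus>b\<in>set bs. l b \<otimes> b)"
  have sR: "s n b \<in> carrier R" if "b \<in> set bs" for n b using s that kR by blast
  have lR: "l b \<in> carrier R" if "b \<in> set bs" for b using l that kR by blast
  have yR: "y \<in> carrier R" unfolding y_def using lR bR by (intro finsum_closed) auto
  have small: "v (x \<ominus> y) \<le> v p ^ n" for n
  proof -
    define S where "S = (\<Oplus>b\<in>set bs. s n b \<otimes> b)"
    have SR: "S \<in> carrier R" unfolding S_def using sR bR by (intro finsum_closed) auto
    have "S = (\<Oplus>b\<in>set bs. l b \<otimes> b \<oplus> (s n b \<ominus> l b) \<otimes> b)"
      unfolding S_def
    proof (rule finsum_cong')
      fix b assume b: "b \<in> set bs"
      have "l b \<oplus> (s n b \<ominus> l b) = s n b"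
        using sR[OF b] lR[OF b]
        by (simp add: minus_eq a_comm[OF sR[OF b] a_inv_closed[OF lR[OF b]]] r_neg1 r_neg2)
      then show "s n b \<otimes> b = l b \<otimes> b \<oplus> (s n b \<ominus> l b) \<otimes> b"
        using sR[OF b] lR[OF b] bR[OF b] by (simp flip: l_distr)
    qed (use sR lR bR in auto)
    also have "\<dots> = y \<oplus> (\<Oplus>b\<in>set bs. (s n b \<ominus> l b) \<otimes> b)"
      unfolding y_def using sR lR bR by (intro finsum_addf) auto
    finally have "S = y \<oplus> (\<Oplus>b\<in>set bs. (s n b \<ominus> l b) \<otimes> b)" .
    moreover have DR: "(\<Oplus>b\<in>set bs. (s n b \<ominus> l b) \<otimes> b) \<in> carrier R"
      using sR lR bR by (intro finsum_closed) auto
    ultimately have "x \<ominus> y = (x \<ominus> S) \<oplus> (\<Oplus>b\<in>set bs. (s n b \<ominus> l b) \<otimes> b)"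
      using x yR by (simp add: minus_eq minus_add a_assoc l_neg)
    then have "v (x \<ominus> y) \<le> max (v (x \<ominus> S)) (v (\<Oplus>b\<in>set bs. (s n b \<ominus> l b) \<otimes> b))"
      using absval_add[OF v _ DR, of "x \<ominus> S"] x SR by simp
    moreover have "v (\<Oplus>b\<in>set bs. (s n b \<ominus> l b) \<otimes> b) \<le> v p ^ n"
    proof (rule absval_finsum_le[OF v])
      fix b assume b: "b \<in> set bs"
      have "v (s n b \<ominus> l b) * v b \<le> v p ^ n * 1"
        using lim[OF b] bs(3)[OF b] p absval_nonneg[OF v bR[OF b]] by (intro mult_mono) auto
      then show "v ((s n b \<ominus> l b) \<otimes> b) \<le> v p ^ n"
        using absval_mult[OF v] sR[OF b] lR[OF b] bR[OF b] by simp
    qed (use p sR lR bR in auto)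
    ultimately show ?thesis using approx[of n] by (simp add: S_def)
  qed
  have "v (x \<ominus> y) \<le> 0"
    using p small by (intro LIMSEQ_le_const[OF LIMSEQ_realpow_zero[of "v p"]]) auto
  then have "v (x \<ominus> y) = 0" using absval_nonneg[OF v, of "x \<ominus> y"] x yR by simp
  then have "x = y" using absval_eq_0[OF v, of "x \<ominus> y"] x yR by simp
  moreover have "l b \<otimes> b \<in> Span k bs" if "b \<in> set bs" for b
    using Span_base_incl[OF k bs(2)] that l[OF that] by (intro Span_smult_closed[OF k bs(2)]) auto
  then have "y \<in> Span k bs"
    unfolding y_def
  proof -
    assume *: "\<And>b. b \<in> set bs \<Longrightarrow> l b \<otimes> b \<in> Span k bs"
    have "(\<Oplus>b\<in>A. l b \<otimes> b) \<in> Span k bs" if "finite A" "A \<subseteq> set bs" for A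
      using that
    proof (induction A rule: finite_induct)
      case empty
      then show ?case using Span_subgroup_props(2)[OF k bs(2)] by simp
    next
      case (insert b A)
      then show ?case
        using * lR bR by (subst finsum_insert)
          (auto simp del: Span.simps intro!: Span_subgroup_props(3)[OF k bs(2)])
    qed
    then show "(\<Oplus>b\<in>set bs. l b \<otimes> b) \<in> Span k bs" by blast
  qed
  ultimately show ?thesis by simp
qed

text \<open>
  A form of Nakayama's lemma: if the integers are finite modulo \<open>p\<close>, then the representatives span
  them over the complete field \<open>k\<close>; every element becomes integral after multiplication by a
  power of \<open>p\<close>, so they span the whole field.
\<close>

lemma (in field) finite_dimension_if_finite_net:
  assumes v: "nonarch_absval R (carrier R) v" and k: "subfield k R"
    and complete: "Metric_space.mcomplete k (absval_dist R k v)"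
    and p: "p \<in> k" "0 < v p" "v p < 1"
    and B: "finite B" "B \<subseteq> carrier R" "\<And>b. b \<in> B \<Longrightarrow> v b \<le> 1"
    and net: "\<And>x. x \<in> carrier R \<Longrightarrow> v x \<le> 1 \<Longrightarrow> \<exists>b\<in>B. v (x \<ominus> b) \<le> v p"
  shows "finite_dimension k (carrier R)"
proof -
  obtain bs where bs: "set bs = B" "distinct bs" using finite_distinct_list[OF B(1)] by blast
  note kring = subfieldE(1)[OF k]
  have bsR: "set bs \<subseteq> carrier R" using bs B by auto
  have pR: "p \<in> carrier R" using p subringE(1)[OF kring] by auto
  have "x \<in> Span k bs" if x: "x \<in> carrier R" for x
  proof -
    obtain n where n: "v p ^ n * v x \<le> 1"
    proof (cases "v x = 0")
      case False
      then have "v x > 0" using absval_nonneg[OF v x] by simp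
      then obtain n where "v p ^ n < 1 / v x" using real_arch_pow_inv[of "1 / v x" "v p"] p by auto
      then show ?thesis using that[of n] \<open>v x > 0\<close> by (simp add: field_simps)
    qed (use that in auto)
    define q where "q = p [^] n"
    have qR: "q \<in> carrier R" and vq: "v q = v p ^ n"
      using pR absval_pow[OF v pR] by (auto simp: q_def)
    then have q0: "q \<noteq> \<zero>" using p absval_eq_0[OF v qR] by auto
    have qk: "q \<in> k"
      unfolding q_def by (induction n) (auto intro: subringE(3,6)[OF kring] p)
    have "q \<otimes> x \<in> Span k bs"
      using bs B net n x qR vq absval_mult[OF v qR x]
      by (intro integral_in_Span_of_finite_net[OF v k complete p]) auto
    then show ?thesis
      using Span_m_inv_simprule[OF k bsR _ x] q0 qk by blast
  qed
  then have "Span k bs = carrier R"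
    using Span_in_carrier[OF subringE(1)[OF kring] bsR] by blast
  then show ?thesis using Span_finite_dimension[OF k bsR] by simp
qed

text \<open>
  In infinite dimension no finite set of integers is a net of radius \<open>v p\<close>, so a sequence of
  integers with mutual distances above \<open>v p\<close> can be chosen one element at a time. Dividing it by \<open>p\<close>
  scales the distances above 1, and the values stay bounded.
\<close>

lemma (in field) separated_sequence:
  assumes v: "nonarch_absval R (carrier R) v" and k: "subfield k R"
    and complete: "Metric_space.mcomplete k (absval_dist R k v)"
    and p: "p \<in> k" "0 < v p" "v p < 1"
    and inf: "infinite_dimension k (carrier R)"
  obtains a :: "nat \<Rightarrow> 'a" where "\<And>i. a i \<in> carrier R" "\<And>i. v (a i) \<le> 1 / v p"
    and "\<And>i j. i \<noteq> j \<Longrightarrow> v (a i \<ominus> a j) > 1"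
proof -
  have pR: "p \<in> carrier R" using p subfieldE(3)[OF k] by auto
  have p0: "p \<noteq> \<zero>" using p absval_eq_0[OF v pR] by auto
  then have pU: "p \<in> Units R" using pR by (simp add: field_Units)
  define P where "P f n x \<longleftrightarrow> x \<in> carrier R \<and> v x \<le> 1 \<and> (\<forall>i<n. v (x \<ominus> f i) > v p)"
    for f :: "nat \<Rightarrow> 'a" and n :: nat and x
  have "\<exists>e. \<forall>n. P e n (e n)"
  proof (rule dependent_wellorder_choice)
    fix n :: nat and f assume f: "\<And>i. i < n \<Longrightarrow> P f i (f i)"
    show "\<exists>x. P f n x"
    proof (rule ccontr)
      assume no: "\<nexists>x. P f n x"
      have "finite_dimension k (carrier R)"
      proof (rule finite_dimension_if_finite_net[OF v k complete p])
        show "\<exists>b\<in>f ` {..<n}. v (x \<ominus> b) \<le> v p" if "x \<in> carrier R" "v x \<le> 1" for x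
          using no that unfolding P_def by (meson imageI lessThan_iff not_le)
      qed (use f in \<open>auto simp: P_def\<close>)
      with inf show False by contradiction
    qed
  qed (auto simp: P_def)
  then obtain e where e: "\<And>n. P e n (e n)" by blast
  have eR: "e n \<in> carrier R" and e1: "v (e n) \<le> 1" for n using e by (auto simp: P_def)
  have sep: "v (e i \<ominus> e j) > v p" if "i \<noteq> j" for i j
  proof (cases "j < i")
    case True
    then show ?thesis using e[of i] by (simp add: P_def)
  next
    case False
    then have "v (e j \<ominus> e i) > v p" using e[of j] that by (simp add: P_def)
    then show ?thesis using absval_minus_commute[OF v eR eR] by simp
  qed
  show ?thesis
  proof
    fix i
    show "inv p \<otimes> e i \<in> carrier R" using pU eR by simp
    show "v (inv p \<otimes> e i) \<le> 1 / v p"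
      using absval_mult[OF v] absval_inv[OF v pR p0] pU eR e1 p by (simp add: divide_right_mono)
    fix j assume "i \<noteq> (j :: nat)"
    have "inv p \<otimes> e i \<ominus> inv p \<otimes> e j = inv p \<otimes> (e i \<ominus> e j)"
      using pU eR by (simp add: minus_eq r_distr r_minus)
    then have "v (inv p \<otimes> e i \<ominus> inv p \<otimes> e j) = v (e i \<ominus> e j) / v p"
      using absval_mult[OF v] absval_inv[OF v pR p0] pU eR by simp
    then show "v (inv p \<otimes> e i \<ominus> inv p \<otimes> e j) > 1"
      using sep[OF \<open>i \<noteq> j\<close>] p by simp
  qed
qed

section \<open>Characters of the projective limit\<close>

context char_zero_tower begin

lemma character_pairing:
  assumes \<psi>: "additive_character R (F 0) v \<psi>" and y: "y \<in> proj_limit R F"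
    and a: "a \<in> carrier R" and b: "b \<in> carrier R"
  shows norm_character_pairing: "norm (\<psi> (tower_pairing R F a y)) = 1"
    and character_pairing_minus: "\<psi> (tower_pairing R F (a \<ominus> b) y)
          = \<psi> (tower_pairing R F a y) * cnj (\<psi> (tower_pairing R F b y))"
proof -
  have norm: "norm (\<psi> (tower_pairing R F c y)) = 1" if "c \<in> carrier R" for c
    using \<psi> tower_pairing_closed[OF y that] by (simp add: additive_character_def)
  then show "norm (\<psi> (tower_pairing R F a y)) = 1" using a .
  have "a = (a \<ominus> b) \<oplus> b" using a b by (simp add: minus_eq a_assoc l_neg)
  then have "tower_pairing R F a y = tower_pairing R F (a \<ominus> b) y \<oplus> tower_pairing R F b y"
    using tower_pairing_add[OF y, of "a \<ominus> b" b] a b by simp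
  then have "\<psi> (tower_pairing R F a y)
      = \<psi> (tower_pairing R F (a \<ominus> b) y) * \<psi> (tower_pairing R F b y)"
    using \<psi> tower_pairing_closed[OF y, of "a \<ominus> b"] tower_pairing_closed[OF y b] a b
    by (simp add: additive_character_def)
  then show "\<psi> (tower_pairing R F (a \<ominus> b) y)
      = \<psi> (tower_pairing R F a y) * cnj (\<psi> (tower_pairing R F b y))"
    using complex_norm_square[of "\<psi> (tower_pairing R F b y)"] norm[OF b] by simp
qed

end

lemma space_borel_prob_with_fourier:
  assumes "borel_prob_with_fourier R F v \<psi> M g"
  shows "space M = proj_limit R F"
  using assms sets_eq_imp_space_eq[of M "proj_limit_borel R F v"]
  by (simp add: borel_prob_with_fourier_def proj_limit_borel_def space_measure_of_conv)

lemma exp_le_rho: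
  assumes "s \<le> C" "0 \<le> \<alpha>" "0 \<le> t"
  shows "exp (- t * C powr \<alpha>) \<le> rho \<alpha> s t"
proof (cases "s > 1")
  case True
  then have "s powr \<alpha> \<le> C powr \<alpha>" using assms by (intro powr_mono2) auto
  then show ?thesis using True assms by (simp add: rho_def mult_left_mono)
qed (use assms in \<open>simp add: rho_def\<close>)

theorem theorem3:
  fixes R :: "('a, 'b) ring_scheme"
    and F :: "nat \<Rightarrow> 'a set"
    and v :: "'a \<Rightarrow> real"
    and \<psi> :: "'a \<Rightarrow> complex"
    and \<mu> heat :: "(nat \<Rightarrow> 'a) measure"
    and \<alpha> t :: real
  assumes "field R" and "char_zero R"
    and "extension_tower R F"
    and "nonarch_local_field R (F 0) v" and "normalized_absval R (F 0) v"
    and "nonarch_absval R (carrier R) v"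
    and "additive_character R (F 0) v \<psi>" and "rank_zero (F 0) v \<psi>"
    and "is_mu R F v \<psi> \<mu>"
    and "\<alpha> > 0" and "t > 0"
    and "is_heat_measure R F v \<psi> \<alpha> t heat"
  shows "\<not> absolutely_continuous \<mu> heat"
proof -
  interpret char_zero_tower R F
    using assms by (auto simp: char_zero_tower_def char_zero_tower_axioms_def)
  note v = \<open>nonarch_absval R (carrier R) v\<close> and \<psi> = \<open>additive_character R (F 0) v \<psi>\<close>
  have mu: "borel_prob_with_fourier R F v \<psi> \<mu> (\<lambda>a. if v a \<le> 1 then 1 else 0)"
    using assms by (simp add: is_mu_def)
  have ht: "borel_prob_with_fourier R F v \<psi> heat (\<lambda>a. rho \<alpha> (v a) t)"
    using assms by (simp add: is_heat_measure_def)
  have sets: "sets heat = sets \<mu>"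
    using mu ht by (simp add: borel_prob_with_fourier_def)
  have complete: "Metric_space.mcomplete (F 0) (absval_dist R (F 0) v)"
    using assms by (simp add: nonarch_local_field_def)
  obtain x where x: "x \<in> F 0" "x \<noteq> \<zero>\<^bsub>R\<^esub>" "v x \<noteq> 1"
    using assms by (auto simp: nonarch_local_field_def)
  \<comment> \<open>An element of value different from 1, or its inverse, has value below 1.\<close>
  obtain p where p: "p \<in> F 0" "0 < v p" "v p < 1"
  proof -
    have xR: "x \<in> carrier R" using tower_carrier[OF x(1)] .
    have vx: "0 < v x" using absval_nonneg[OF v xR] absval_eq_0[OF v xR] x by simp
    consider "v x < 1" | "v x > 1" using x by linarith
    then show ?thesis
    proof cases
      case 2
      then have "v (inv\<^bsub>R\<^esub> x) < 1" "0 < v (inv\<^bsub>R\<^esub> x)" using absval_inv[OF v xR x(2)] by auto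
      moreover have "inv\<^bsub>R\<^esub> x \<in> F 0" using subfield_m_inv(1)[OF subfield_tower] x by blast
      ultimately show ?thesis using that by blast
    qed (use that x vx in blast)
  qed
  have "\<not> ring.finite_dimension R (F 0) (carrier R)"
    using tower unfolding extension_tower_def by blast
  from separated_sequence[OF v subfield_tower complete p this]
  obtain a :: "nat \<Rightarrow> 'a" where a: "\<And>i. a i \<in> carrier R" and bound: "\<And>i. v (a i) \<le> 1 / v p"
    and sep: "\<And>i j. i \<noteq> j \<Longrightarrow> v (a i \<ominus>\<^bsub>R\<^esub> a j) > 1"
    by blast
  define Y where "Y i y = \<psi> (tower_pairing R F (a i) y)" for i y
  have rho_pos: "exp (- t * (1 / v p) powr \<alpha>) \<le> rho \<alpha> (v (a i)) t" for i
    using bound assms by (intro exp_le_rho) auto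
  have heat_mean: "(\<integral>y. Y i y \<partial>heat) = complex_of_real (rho \<alpha> (v (a i)) t)" for i
    using ht a by (simp add: borel_prob_with_fourier_def Y_def)
  show ?thesis
  proof (rule not_absolutely_continuous_if_orthonormal[where Y = Y])
    show "prob_space \<mu>" "prob_space heat" "sets heat = sets \<mu>"
      using mu ht sets by (auto simp: borel_prob_with_fourier_def)
    show "Y i \<in> borel_measurable \<mu>" for i
    proof -
      \<comment> \<open>A Bochner integral different from 0 exists only for an integrable function, so the nonzero
        transform of \<open>heat\<close> makes \<open>Y i\<close> measurable; the two measures have the same measurable sets.\<close>
      have "rho \<alpha> (v (a i)) t \<noteq> 0" using rho_pos[of i] exp_gt_zero by (metis not_le)
      then have "(\<integral>y. Y i y \<partial>heat) \<noteq> 0" using heat_mean by simp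
      then have "integrable heat (Y i)" using not_integrable_integral_eq by blast
      then have "Y i \<in> borel_measurable heat" by (rule borel_measurable_integrable)
      then show ?thesis using measurable_cong_sets[OF sets refl] by blast
    qed
    show "norm (Y i y) = 1" if "y \<in> space \<mu>" for i y
      using that norm_character_pairing[OF \<psi> _ a a] space_borel_prob_with_fourier[OF mu]
      by (simp add: Y_def)
    show "(\<integral>y. Y i y * cnj (Y j y) \<partial>\<mu>) = 0" if "i \<noteq> j" for i j
    proof -
      have "(\<integral>y. Y i y * cnj (Y j y) \<partial>\<mu>) = (\<integral>y. \<psi> (tower_pairing R F (a i \<ominus>\<^bsub>R\<^esub> a j) y) \<partial>\<mu>)"
        using character_pairing_minus[OF \<psi> _ a a] space_borel_prob_with_fourier[OF mu]
        by (intro Bochner_Integration.integral_cong) (auto simp: Y_def)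
      also have "\<dots> = 0"
        using mu a sep[OF that] by (simp add: borel_prob_with_fourier_def)
      finally show ?thesis .
    qed
    show "0 < exp (- t * (1 / v p) powr \<alpha>)" by simp
    show "exp (- t * (1 / v p) powr \<alpha>) \<le> Re (\<integral>y. Y i y \<partial>heat)" for i
      using rho_pos heat_mean by simp
  qed
qed

end
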